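(* For each integer $\beta \geq 5$, the groups \[ \Gamma^{8, 2^{\beta}}(3,\ 1-2^{\beta-2},\ -3,\ -1-2^{\beta-2}) \quad\text{and}\quad \Gamma^{8, 2^{\beta}}(3,\ 1+2^{\beta-2},\ -3,\ -1+2^{\beta-2}) \] are the automorphism groups of tight chiral polyhedra of type $\{8, 2^{\beta}\}$.
   Context: For integers $p,q,i_1,j_1,i_2,j_2$, $\Gamma^{p,q}(i_1,j_1,i_2,j_2)$ denotes the group with presentation $\langle \sigma_1,\sigma_2 \mid \sigma_1^p=\sigma_2^q=(\sigma_1\sigma_2)^2=1,\ \sigma_2^{-1}\sigma_1=\sigma_1^{i_1}\sigma_2^{j_1},\ \sigma_2\sigma_1^{-1}=\sigma_1^{i_2}\sigma_2^{j_2}\rangle$. An (abstract) polyhedron is a partially ordered set whose elements have rank $0$, $1$, $2$ (vertices, edges, faces), incidence meaning comparability, such that every edge is incident to exactly two vertices and two faces, whenever a vertex is incident to a face exactly two edges are incident to both, the incidence graph is connected, and for each vertex or face the subgraph of the incidence graph induced on its neighbours is connected. A flag is a mutually incident (vertex, edge, face) triple; $\Phi^i$ is the flag differing from $\Phi$ exactly in its rank-$i$ element. Type $\{p,q\}$: faces are incident to $p$ edges and vertices to $q$ edges. The polyhedron is chiral if its flags split into two classes with $\Phi,\Phi^i$ always in different classes and the automorphism group transitive on each class but not on all flags; then, fixing a base flag $\Phi$, the automorphism group is generated by $\sigma_1:\Phi\mapsto(\Phi^1)^0$ and $\sigma_2:\Phi\mapsto(\Phi^2)^1$. A group $\langle\sigma_1,\sigma_2\rangle$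 "is the automorphism group of" such a polyhedron if there is an isomorphism onto it sending the generators $\sigma_1,\sigma_2$ to these distinguished generators. A polyhedron of type $\{p,q\}$ is tight if it has exactly $2pq$ flags. *)

theory Defs
  imports "HOL-Algebra.Bij"
begin

section \<open>Groups given by a presentation\<close>

text \<open>The letter \<open>(x, True)\<close> stands for the generator \<open>x\<close> and \<open>(x, False)\<close> for its inverse.
  Every element of the type \<open>'g\<close> is a generator.\<close>

type_synonym 'g word = "('g \<times> bool) list"

definition gpow :: "'g \<Rightarrow> int \<Rightarrow> 'g word" where
  "gpow x k = replicate (nat \<bar>k\<bar>) (x, k \<ge> 0)"

inductive pres_eq :: "('g word \<times> 'g word) set \<Rightarrow> 'g word \<Rightarrow> 'g word \<Rightarrow> bool"
  for R where
  refl: "pres_eq R u u"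
| sym: "pres_eq R u v \<Longrightarrow> pres_eq R v u"
| trans: "pres_eq R u v \<Longrightarrow> pres_eq R v w \<Longrightarrow> pres_eq R u w"
| cancel: "pres_eq R (u @ [(x, b), (x, \<not> b)] @ v) (u @ v)"
| relation: "(l, r) \<in> R \<Longrightarrow> pres_eq R (u @ l @ v) (u @ r @ v)"

definition word_class :: "('g word \<times> 'g word) set \<Rightarrow> 'g word \<Rightarrow> 'g word set" where
  "word_class R u = {v. pres_eq R u v}"

definition presented_group :: "('g word \<times> 'g word) set \<Rightarrow> 'g word set monoid" where
  "presented_group R =
    \<lparr>carrier = range (word_class R),
     mult = \<lambda>X Y. \<Union>u\<in>X. \<Union>v\<in>Y. word_class R (u @ v),
     one = word_class R []\<rparr>"

definition generator :: "('g word \<times> 'g word) set \<Rightarrow> 'g \<Rightarrow> 'g word set" where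
  "generator R x = word_class R (gpow x 1)"

lemma pres_eq_append:
  assumes "pres_eq R u u'" "pres_eq R v v'"
  shows "pres_eq R (u @ v) (u' @ v')"
proof -
  have ctxt: "pres_eq R (a @ w @ c) (a @ w' @ c)" if "pres_eq R w w'" for a w w' c
    using that
  proof induction
    case (refl u)
    show ?case by (rule pres_eq.refl)
  next
    case (sym u v)
    show ?case using sym.IH by (rule pres_eq.sym)
  next
    case (trans u v w)
    show ?case using trans.IH by (rule pres_eq.trans)
  next
    case (cancel u x b v)
    show ?case using pres_eq.cancel[of R "a @ u" x b "v @ c"] by simp
  next
    case (relation l r u v)
    then show ?case using pres_eq.relation[of l r R "a @ u" "v @ c"] by simp
  qed
  have "pres_eq R (u @ v) (u' @ v)" using ctxt[OF assms(1), of "[]" v] by simp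
  moreover have "pres_eq R (u' @ v) (u' @ v')" using ctxt[OF assms(2), of u' "[]"] by simp
  ultimately show ?thesis by (rule pres_eq.trans)
qed

lemma word_class_eq_iff: "word_class R u = word_class R v \<longleftrightarrow> pres_eq R u v"
proof
  assume "word_class R u = word_class R v"
  moreover have "v \<in> word_class R v" by (simp add: word_class_def pres_eq.refl)
  ultimately have "v \<in> word_class R u" by simp
  then show "pres_eq R u v" by (simp add: word_class_def)
next
  assume uv: "pres_eq R u v"
  have "pres_eq R u w \<longleftrightarrow> pres_eq R v w" for w
    using pres_eq.trans[OF uv] pres_eq.trans[OF pres_eq.sym[OF uv]] by (rule iffI[rotated])
  then show "word_class R u = word_class R v" by (simp add: word_class_def)
qed

lemma mult_word_class:
  "word_class R u \<otimes>\<^bsub>presented_group R\<^esub> word_class R v = word_class R (u @ v)"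
proof -
  have eq: "word_class R (u' @ v') = word_class R (u @ v)"
    if "u' \<in> word_class R u" "v' \<in> word_class R v" for u' v'
  proof -
    have "pres_eq R (u @ v) (u' @ v')"
      using that by (intro pres_eq_append) (simp_all add: word_class_def)
    then show ?thesis by (simp add: word_class_eq_iff[symmetric])
  qed
  have "u \<in> word_class R u" "v \<in> word_class R v"
    by (simp_all add: word_class_def pres_eq.refl)
  then have "(\<Union>u'\<in>word_class R u. \<Union>v'\<in>word_class R v. word_class R (u' @ v')) =
      word_class R (u @ v)"
    using eq by blast
  then show ?thesis by (simp add: presented_group_def)
qed

lemma group_presented_group: "group (presented_group R)"
proof (rule groupI)
  show "\<one>\<^bsub>presented_group R\<^esub> \<in> carrier (presented_group R)"
    by (simp add: presented_group_def)
next
  fix x y assume "x \<in> carrier (presented_group R)" "y \<in> carrier (presented_group R)"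
  then obtain u v where "x = word_class R u" "y = word_class R v"
    by (auto simp: presented_group_def)
  then show "x \<otimes>\<^bsub>presented_group R\<^esub> y \<in> carrier (presented_group R)"
    by (simp only: mult_word_class) (simp add: presented_group_def)
next
  fix x y z assume "x \<in> carrier (presented_group R)" "y \<in> carrier (presented_group R)"
    "z \<in> carrier (presented_group R)"
  then obtain u v w where "x = word_class R u" "y = word_class R v" "z = word_class R w"
    by (auto simp: presented_group_def)
  then show "x \<otimes>\<^bsub>presented_group R\<^esub> y \<otimes>\<^bsub>presented_group R\<^esub> z =
      x \<otimes>\<^bsub>presented_group R\<^esub> (y \<otimes>\<^bsub>presented_group R\<^esub> z)"
    by (simp add: mult_word_class)
next
  fix x assume "x \<in> carrier (presented_group R)"
  then obtain u where u: "x = word_class R u"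
    by (auto simp: presented_group_def)
  have one: "\<one>\<^bsub>presented_group R\<^esub> = word_class R []"
    by (simp add: presented_group_def)
  show "\<one>\<^bsub>presented_group R\<^esub> \<otimes>\<^bsub>presented_group R\<^esub> x = x"
    by (simp add: u one mult_word_class)
  have "\<exists>v. pres_eq R (v @ u) []"
  proof (induction u)
    case Nil
    show ?case by (auto intro: pres_eq.refl)
  next
    case (Cons a u)
    then obtain v where v: "pres_eq R (v @ u) []" by blast
    obtain x b where a: "a = (x, b)" by fastforce
    have "pres_eq R ((v @ [(x, \<not> b)]) @ a # u) (v @ u)"
      using pres_eq.cancel[of R v x "\<not> b" u] by (simp add: a)
    then show ?case using v pres_eq.trans by blast
  qed
  then obtain v where "pres_eq R (v @ u) []" by blast
  then have "word_class R v \<otimes>\<^bsub>presented_group R\<^esub> x = \<one>\<^bsub>presented_group R\<^esub>"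
    by (simp add: u one mult_word_class word_class_eq_iff)
  then show "\<exists>y\<in>carrier (presented_group R). y \<otimes>\<^bsub>presented_group R\<^esub> x = \<one>\<^bsub>presented_group R\<^esub>"
    by (auto simp: presented_group_def)
qed

datatype gen = Sigma1 | Sigma2

definition Gamma_rels ::
    "int \<Rightarrow> int \<Rightarrow> int \<Rightarrow> int \<Rightarrow> int \<Rightarrow> int \<Rightarrow> (gen word \<times> gen word) set" where
  "Gamma_rels p q i1 j1 i2 j2 =
    {(gpow Sigma1 p, []),
     (gpow Sigma2 q, []),
     (gpow Sigma1 1 @ gpow Sigma2 1 @ gpow Sigma1 1 @ gpow Sigma2 1, []),
     (gpow Sigma2 (-1) @ gpow Sigma1 1, gpow Sigma1 i1 @ gpow Sigma2 j1),
     (gpow Sigma2 1 @ gpow Sigma1 (-1), gpow Sigma1 i2 @ gpow Sigma2 j2)}"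


section \<open>Abstract polyhedra\<close>

record 'a ranked_poset =
  elements :: "'a set"
  order_rel :: "('a \<times> 'a) set"
  rank :: "'a \<Rightarrow> nat"

definition of_rank :: "'a ranked_poset \<Rightarrow> nat \<Rightarrow> 'a set" where
  "of_rank P i = {x \<in> elements P. rank P x = i}"

abbreviation vertices :: "'a ranked_poset \<Rightarrow> 'a set" where "vertices P \<equiv> of_rank P 0"
abbreviation edges :: "'a ranked_poset \<Rightarrow> 'a set" where "edges P \<equiv> of_rank P 1"
abbreviation faces :: "'a ranked_poset \<Rightarrow> 'a set" where "faces P \<equiv> of_rank P 2"

definition incident :: "'a ranked_poset \<Rightarrow> 'a \<Rightarrow> 'a \<Rightarrow> bool" where
  "incident P x y \<longleftrightarrow> (x, y) \<in> order_rel P \<or> (y, x) \<in> order_rel P"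

definition neighbours :: "'a ranked_poset \<Rightarrow> 'a \<Rightarrow> 'a set" where
  "neighbours P x = {y \<in> elements P. y \<noteq> x \<and> incident P x y}"

text \<open>Connectedness of the subgraph of the incidence graph induced on a set of elements.\<close>

definition incidence_connected :: "'a ranked_poset \<Rightarrow> 'a set \<Rightarrow> bool" where
  "incidence_connected P S \<longleftrightarrow>
    S \<noteq> {} \<and> (\<forall>x\<in>S. \<forall>y\<in>S. (x, y) \<in> {(u, v). u \<in> S \<and> v \<in> S \<and> incident P u v}\<^sup>*)"

definition polyhedron :: "'a ranked_poset \<Rightarrow> bool" where
  "polyhedron P \<longleftrightarrow>
    partial_order_on (elements P) (order_rel P) \<and>
    (\<forall>x\<in>elements P. rank P x \<in> {0, 1, 2}) \<and>
    (\<forall>(x, y)\<in>order_rel P. x \<noteq> y \<longrightarrow> rank P x < rank P y) \<and>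
    (\<forall>e\<in>edges P. card {v \<in> vertices P. incident P e v} = 2 \<and>
                  card {f \<in> faces P. incident P e f} = 2) \<and>
    (\<forall>v\<in>vertices P. \<forall>f\<in>faces P. incident P v f \<longrightarrow>
      card {e \<in> edges P. incident P e v \<and> incident P e f} = 2) \<and>
    incidence_connected P (elements P) \<and>
    (\<forall>x\<in>vertices P \<union> faces P. incidence_connected P (neighbours P x))"

type_synonym 'a flag = "'a \<times> 'a \<times> 'a"

definition flags :: "'a ranked_poset \<Rightarrow> 'a flag set" where
  "flags P = {(v, e, f). v \<in> vertices P \<and> e \<in> edges P \<and> f \<in> faces P \<and>
    incident P v e \<and> incident P e f \<and> incident P v f}"

fun flag_elem :: "'a flag \<Rightarrow> nat \<Rightarrow> 'a" where
  "flag_elem (v, e, f) i = (if i = 0 then v else if i = 1 then e else f)"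

definition adj_flag :: "'a ranked_poset \<Rightarrow> nat \<Rightarrow> 'a flag \<Rightarrow> 'a flag" where
  "adj_flag P i \<Phi> =
    (THE \<Psi>. \<Psi> \<in> flags P \<and> (\<forall>j\<in>{0, 1, 2}. flag_elem \<Psi> j \<noteq> flag_elem \<Phi> j \<longleftrightarrow> j = i))"

definition has_type :: "'a ranked_poset \<Rightarrow> nat \<Rightarrow> nat \<Rightarrow> bool" where
  "has_type P p q \<longleftrightarrow>
    (\<forall>f\<in>faces P. card {e \<in> edges P. incident P e f} = p) \<and>
    (\<forall>v\<in>vertices P. card {e \<in> edges P. incident P e v} = q)"

definition automorphisms :: "'a ranked_poset \<Rightarrow> ('a \<Rightarrow> 'a) set" where
  "automorphisms P = {g \<in> Bij (elements P).
    \<forall>x\<in>elements P. \<forall>y\<in>elements P. (x, y) \<in> order_rel P \<longleftrightarrow> (g x, g y) \<in> order_rel P}"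

text \<open>Automorphisms act on the right, as is customary for polytopes: the product of \<open>g\<close> and
  \<open>h\<close> is \<open>g\<close> followed by \<open>h\<close>.\<close>

definition Aut :: "'a ranked_poset \<Rightarrow> ('a \<Rightarrow> 'a) monoid" where
  "Aut P = \<lparr>carrier = automorphisms P,
            mult = \<lambda>g h. compose (elements P) h g,
            one = \<lambda>x\<in>elements P. x\<rparr>"

definition act :: "('a \<Rightarrow> 'a) \<Rightarrow> 'a flag \<Rightarrow> 'a flag" where
  "act g = map_prod g (map_prod g g)"

definition flag_transitive_on :: "'a ranked_poset \<Rightarrow> 'a flag set \<Rightarrow> bool" where
  "flag_transitive_on P F \<longleftrightarrow> (\<forall>\<Phi>\<in>F. \<forall>\<Psi>\<in>F. \<exists>g\<in>automorphisms P. act g \<Phi> = \<Psi>)"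

definition chiral_polyhedron :: "'a ranked_poset \<Rightarrow> bool" where
  "chiral_polyhedron P \<longleftrightarrow>
    polyhedron P \<and>
    (\<exists>A B. A \<union> B = flags P \<and> A \<inter> B = {} \<and>
      (\<forall>\<Phi>\<in>flags P. \<forall>i\<in>{0, 1, 2}. \<Phi> \<in> A \<longleftrightarrow> adj_flag P i \<Phi> \<in> B) \<and>
      flag_transitive_on P A \<and> flag_transitive_on P B) \<and>
    \<not> flag_transitive_on P (flags P)"

definition tight :: "'a ranked_poset \<Rightarrow> nat \<Rightarrow> nat \<Rightarrow> bool" where
  "tight P p q \<longleftrightarrow> has_type P p q \<and> card (flags P) = 2 * p * q"

definition distinguished_generators ::
    "'a ranked_poset \<Rightarrow> 'a flag \<Rightarrow> ('a \<Rightarrow> 'a) \<Rightarrow> ('a \<Rightarrow> 'a) \<Rightarrow> bool" where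
  "distinguished_generators P \<Phi> s1 s2 \<longleftrightarrow>
    s1 \<in> automorphisms P \<and> act s1 \<Phi> = adj_flag P 0 (adj_flag P 1 \<Phi>) \<and>
    s2 \<in> automorphisms P \<and> act s2 \<Phi> = adj_flag P 1 (adj_flag P 2 \<Phi>)"

definition presents_automorphism_group :: "(gen word \<times> gen word) set \<Rightarrow> 'a ranked_poset \<Rightarrow> bool" where
  "presents_automorphism_group R P \<longleftrightarrow>
    (\<exists>\<Phi>\<in>flags P. \<exists>\<phi>\<in>iso (presented_group R) (Aut P).
      distinguished_generators P \<Phi> (\<phi> (generator R Sigma1)) (\<phi> (generator R Sigma2)))"

end

theory Submission
  imports Defs "HOL-Algebra.Multiplicative_Group"
begin

text \<open>Write \<open>a = \<sigma>\<^sub>1\<close>, \<open>b = \<sigma>\<^sub>2\<close>. The vertices, edges and faces of the polyhedron are the right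
  cosets of \<open>\<langle>b\<rangle>\<close>, \<open>\<langle>ab\<rangle>\<close> and \<open>\<langle>a\<rangle>\<close>, incident when they meet, with the group acting by right
  multiplication. If the group is \<open>\<langle>a\<rangle>\<langle>b\<rangle>\<close> with \<open>\<langle>a\<rangle> \<inter> \<langle>b\<rangle> = 1\<close>, every vertex lies on every face, and
  the flags fall into two regular orbits. An automorphism exchanging the orbits would induce a
  group automorphism inverting \<open>a\<close> and \<open>b\<close>; in the groups at hand, that would force
  \<open>b\<^bsup>q/2\<^esup> = 1\<close>.

  With \<open>q = 32|u|\<close> and \<open>j\<^sub>1 = 1 - 8u\<close> the relations say that \<open>a\<^sup>2\<close> normalises \<open>\<langle>b\<rangle>\<close>, whence the
  factorisation; that no further collapse occurs is seen from an explicit action on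
  \<open>\<int>/8 \<times> \<int>/q\<close>.\<close>

section \<open>The polyhedron of a factorised rotation group\<close>

lemma incident_commute: "incident P x y \<longleftrightarrow> incident P y x"
  by (auto simp: incident_def)

text \<open>Incidence is symmetric, so paths out of a single base point \<open>s\<close> can be
  reversed and joined.\<close>

lemma incidence_connectedI:
  assumes "s \<in> S"
    and "\<And>x. x \<in> S \<Longrightarrow> (s, x) \<in> {(u, v). u \<in> S \<and> v \<in> S \<and> incident P u v}\<^sup>*"
  shows "incidence_connected P S"
proof -
  let ?r = "{(u, v). u \<in> S \<and> v \<in> S \<and> incident P u v}"
  have "sym (?r\<^sup>*)"
    by (intro sym_rtrancl symI) (auto simp: incident_def)
  then have "(x, y) \<in> ?r\<^sup>*" if "x \<in> S" "y \<in> S" for x y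
    using that assms(2) by (meson rtrancl_trans symD)
  then show ?thesis
    using assms(1) by (auto simp: incidence_connected_def)
qed

text \<open>The element \<open>a \<otimes> b\<close> has order exactly two:
  \<open>a \<otimes> b = \<one>\<close> would put \<open>a\<close> into <b>, hence into the trivial
  intersection. Natural exponents in the factorisation lose nothing in a finite group.\<close>

locale tight_rotation_group = group G for G (structure) +
  fixes a b
  assumes a_closed [simp, intro]: "a \<in> carrier G"
    and b_closed [simp, intro]: "b \<in> carrier G"
    and finite_carrier: "finite (carrier G)"
    and a_not_one: "a \<noteq> \<one>"
    and b_not_one: "b \<noteq> \<one>"
    and involution: "a \<otimes> b \<otimes> (a \<otimes> b) = \<one>"
    and factorisation: "x \<in> carrier G \<Longrightarrow> \<exists>(i :: nat) (j :: nat). x = a [^] i \<otimes> b [^] j"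
    and trivial_intersection: "a [^] (i :: int) = b [^] (j :: int) \<Longrightarrow> a [^] i = \<one>"
begin

abbreviation C where "C \<equiv> carrier G"

lemma cancel_left [simp]:
  "x \<in> C \<Longrightarrow> g \<in> C \<Longrightarrow> inv x \<otimes> (x \<otimes> g) = g"
  "x \<in> C \<Longrightarrow> g \<in> C \<Longrightarrow> x \<otimes> (inv x \<otimes> g) = g"
  by (simp_all add: m_assoc [symmetric])

section \<open>Cosets and their numerical labels\<close>

definition orbit :: "'a \<Rightarrow> 'a \<Rightarrow> 'a set" where
  "orbit x g = {x [^] k \<otimes> g | k :: int. True}"

lemma orbit_eq_iff:
  assumes "x \<in> C" "g \<in> C" "h \<in> C"
  shows "orbit x g = orbit x h \<longleftrightarrow> (\<exists>k :: int. h = x [^] k \<otimes> g)"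
proof
  assume "orbit x g = orbit x h"
  moreover have "h \<in> orbit x h"
    unfolding orbit_def using assms by (auto intro!: exI[of _ "0 :: int"])
  ultimately show "\<exists>k :: int. h = x [^] k \<otimes> g"
    unfolding orbit_def by blast
next
  assume "\<exists>k :: int. h = x [^] k \<otimes> g"
  then obtain k :: int where k: "h = x [^] k \<otimes> g" by blast
  have "x [^] l \<otimes> g = x [^] (l - k) \<otimes> h" "x [^] l \<otimes> h = x [^] (l + k) \<otimes> g" for l :: int
    using assms by (simp_all add: k m_assoc [symmetric] int_pow_mult [symmetric])
  then show "orbit x g = orbit x h"
    unfolding orbit_def by blast
qed

text \<open>The finitely many subsets of the carrier are numbered, so that the poset lives on the
  natural numbers whatever the type of group elements.\<close>

definition code :: "'a set \<Rightarrow> nat" where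
  "code = (SOME c. inj_on c (Pow C))"

lemma inj_code: "inj_on code (Pow C)"
proof -
  have "\<exists>c :: 'a set \<Rightarrow> nat. inj_on c (Pow C)"
    using finite_imp_inj_to_nat_seg[of "Pow C"] finite_carrier by blast
  then show ?thesis unfolding code_def by (rule someI_ex)
qed

lemma code_eq_iff: "X \<subseteq> C \<Longrightarrow> Y \<subseteq> C \<Longrightarrow> code X = code Y \<longleftrightarrow> X = Y"
  using inj_code by (simp add: inj_on_eq_iff)

text \<open>The labels number the right cosets of <b>, of {1, ab} and of <a>. The residue modulo 3
  keeps the three kinds disjoint as poset elements and serves as the rank.\<close>

definition vtx :: "'a \<Rightarrow> nat" where "vtx g = 3 * code (orbit b g)"
definition edg :: "'a \<Rightarrow> nat" where "edg g = 3 * code {g, a \<otimes> (b \<otimes> g)} + 1"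
definition fac :: "'a \<Rightarrow> nat" where "fac g = 3 * code (orbit a g) + 2"

lemma label_mod [simp]: "vtx g mod 3 = 0" "edg g mod 3 = 1" "fac g mod 3 = 2"
  unfolding vtx_def edg_def fac_def by presburger+

lemma label_dvd [simp]: "3 dvd vtx g" "\<not> 3 dvd edg g" "\<not> 3 dvd fac g"
  unfolding vtx_def edg_def fac_def by presburger+

lemma label_distinct [simp]:
  "vtx g \<noteq> edg h" "edg g \<noteq> vtx h" "vtx g \<noteq> fac h" "fac g \<noteq> vtx h" "edg g \<noteq> fac h" "fac g \<noteq> edg h"
  by (metis label_mod zero_neq_one zero_neq_numeral one_eq_numeral_iff num.distinct(1))+

lemma orbit_subset: "x \<in> C \<Longrightarrow> g \<in> C \<Longrightarrow> orbit x g \<subseteq> C"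
  by (auto simp: orbit_def)

lemma vtx_eq_iff: "g \<in> C \<Longrightarrow> h \<in> C \<Longrightarrow> vtx g = vtx h \<longleftrightarrow> (\<exists>k :: int. h = b [^] k \<otimes> g)"
  by (simp add: vtx_def code_eq_iff orbit_subset orbit_eq_iff)

lemma fac_eq_iff: "g \<in> C \<Longrightarrow> h \<in> C \<Longrightarrow> fac g = fac h \<longleftrightarrow> (\<exists>k :: int. h = a [^] k \<otimes> g)"
  by (simp add: fac_def code_eq_iff orbit_subset orbit_eq_iff)

lemma twist_twist [simp]: "g \<in> C \<Longrightarrow> a \<otimes> (b \<otimes> (a \<otimes> (b \<otimes> g))) = g"
  using involution by (simp add: m_assoc [symmetric])

lemma edg_eq_iff: "g \<in> C \<Longrightarrow> h \<in> C \<Longrightarrow> edg g = edg h \<longleftrightarrow> h = g \<or> h = a \<otimes> (b \<otimes> g)"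
  by (auto simp: edg_def code_eq_iff doubleton_eq_iff)

lemma twist_eq: "g \<in> C \<Longrightarrow> a \<otimes> (b \<otimes> g) = inv b \<otimes> (inv a \<otimes> g)"
  by (metis a_closed b_closed cancel_left(1) inv_closed m_closed twist_twist cancel_left(2))

lemma vtx_pow: "g \<in> C \<Longrightarrow> vtx (b [^] (k :: int) \<otimes> g) = vtx g"
  by (subst eq_commute, subst vtx_eq_iff) auto

lemma fac_pow: "g \<in> C \<Longrightarrow> fac (a [^] (k :: int) \<otimes> g) = fac g"
  by (subst eq_commute, subst fac_eq_iff) auto

lemma label_mult [simp]:
  assumes "g \<in> C"
  shows "vtx (b \<otimes> g) = vtx g" "vtx (inv b \<otimes> g) = vtx g"
    and "fac (a \<otimes> g) = fac g" "fac (inv a \<otimes> g) = fac g"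
  using vtx_pow[OF assms, of 1] vtx_pow[OF assms, of "-1"] fac_pow[OF assms, of 1]
    fac_pow[OF assms, of "-1"] by (simp_all add: int_pow_neg)

text \<open>The edge {g, abg} has the vertices of g and abg as its ends. Since ab is its own
  inverse, abg = b^-1 a^-1 g, and the power of b is absorbed by the vertex.\<close>

lemma vtx_twist: "g \<in> C \<Longrightarrow> vtx (a \<otimes> (b \<otimes> g)) = vtx (inv a \<otimes> g)"
  by (simp add: twist_eq)

lemma edg_twist [simp]: "g \<in> C \<Longrightarrow> edg (a \<otimes> (b \<otimes> g)) = edg g"
  by (subst eq_commute, subst edg_eq_iff) auto

text \<open>Two elements in the same coset of <b> and in the same coset of <a> differ by an element
  of the trivial intersection.\<close>

lemma vtx_fac_inj:
  assumes g: "g \<in> C" and h: "h \<in> C" and "vtx g = vtx h" "fac g = fac h"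
  shows "g = h"
proof -
  obtain i :: int where i: "h = b [^] i \<otimes> g"
    using assms vtx_eq_iff by blast
  obtain j :: int where j: "h = a [^] j \<otimes> g"
    using assms fac_eq_iff by blast
  from i j have "a [^] j = b [^] i"
    using g by (metis a_closed b_closed int_pow_closed right_cancel)
  then have "a [^] j = \<one>" by (rule trivial_intersection)
  then show ?thesis using j g by simp
qed

text \<open>The element \<open>a \<otimes> g\<close> stays on the face of \<open>g\<close>; staying
  at its vertex as well would give \<open>a = \<one>\<close>.\<close>

lemma vtx_a_neq [simp]: "g \<in> C \<Longrightarrow> vtx (a \<otimes> g) \<noteq> vtx g" "g \<in> C \<Longrightarrow> vtx g \<noteq> vtx (a \<otimes> g)"
  using vtx_fac_inj[of "a \<otimes> g" g] a_not_one
  by (metis label_mult(3) m_closed a_closed r_cancel_one)+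

lemma fac_b_neq [simp]: "g \<in> C \<Longrightarrow> fac (b \<otimes> g) \<noteq> fac g" "g \<in> C \<Longrightarrow> fac g \<noteq> fac (b \<otimes> g)"
  using vtx_fac_inj[of "b \<otimes> g" g] b_not_one
  by (metis label_mult(1) m_closed b_closed r_cancel_one)+

lemma vtx_inv_a_neq [simp]:
  "g \<in> C \<Longrightarrow> vtx (inv a \<otimes> g) \<noteq> vtx g" "g \<in> C \<Longrightarrow> vtx g \<noteq> vtx (inv a \<otimes> g)"
  using vtx_a_neq[of "inv a \<otimes> g"] by simp_all

lemma edg_a_neq [simp]: "g \<in> C \<Longrightarrow> edg (a \<otimes> g) \<noteq> edg g" "g \<in> C \<Longrightarrow> edg g \<noteq> edg (a \<otimes> g)"
proof -
  have "edg g \<noteq> edg (a \<otimes> g)" if g: "g \<in> C" for g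
  proof
    assume "edg g = edg (a \<otimes> g)"
    then have "a \<otimes> g = g \<or> a \<otimes> g = a \<otimes> (b \<otimes> g)" using g by (simp add: edg_eq_iff)
    then show False
    proof
      assume "a \<otimes> g = g"
      then show False using vtx_a_neq[OF g] by simp
    next
      assume "a \<otimes> g = a \<otimes> (b \<otimes> g)"
      then have "b \<otimes> g = g" using g by simp
      then show False using fac_b_neq[OF g] by simp
    qed
  qed
  then show "g \<in> C \<Longrightarrow> edg (a \<otimes> g) \<noteq> edg g" "g \<in> C \<Longrightarrow> edg g \<noteq> edg (a \<otimes> g)" by metis+
qed

text \<open>Writing h g^-1 = a^i b^j exhibits an element of both <b>g and <a>h, so every vertex lies
  on every face. The exponents are kept because they measure walks around a vertex or a
  face.\<close>

lemma common_flag: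
  assumes "g \<in> C" "h \<in> C"
  obtains i j :: nat where "b [^] j \<otimes> g = inv (a [^] i) \<otimes> h"
    and "vtx (b [^] j \<otimes> g) = vtx g" and "fac (b [^] j \<otimes> g) = fac h"
proof -
  obtain i j :: nat where "h \<otimes> inv g = a [^] i \<otimes> b [^] j"
    using factorisation[of "h \<otimes> inv g"] assms by (meson inv_closed m_closed)
  then have "h = a [^] i \<otimes> (b [^] j \<otimes> g)"
    using assms by (metis a_closed b_closed inv_closed inv_solve_right' m_assoc m_closed nat_pow_closed)
  then have ij: "b [^] j \<otimes> g = inv (a [^] i) \<otimes> h" using assms by simp
  moreover have "vtx (b [^] j \<otimes> g) = vtx g"
    using vtx_pow[of g "int j"] assms by (simp add: int_pow_int)
  moreover have "fac (b [^] j \<otimes> g) = fac h"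
    using fac_pow[of h "- int i"] assms by (simp add: ij int_pow_neg_int)
  ultimately show ?thesis using that by blast
qed

section \<open>Incidence of cosets\<close>

definition poset :: "nat ranked_poset" where
  "poset = \<lparr>elements = vtx ` C \<union> edg ` C \<union> fac ` C,
    order_rel = Id_on (vtx ` C \<union> edg ` C \<union> fac ` C) \<union>
      (\<lambda>g. (vtx g, edg g)) ` C \<union> (\<lambda>g. (edg g, fac g)) ` C \<union> (\<lambda>g. (vtx g, fac g)) ` C,
    rank = (\<lambda>x. x mod 3)\<rparr>"

lemma of_rank_poset [simp]:
  "vertices poset = vtx ` C" "edges poset = edg ` C" "of_rank poset (Suc 0) = edg ` C"
  "faces poset = fac ` C"
  by (auto simp: of_rank_def poset_def)

lemma elements_poset: "elements poset = vtx ` C \<union> edg ` C \<union> fac ` C"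
  by (simp add: poset_def)

lemma elements_poset_mem [simp]:
  "g \<in> C \<Longrightarrow> vtx g \<in> elements poset" "g \<in> C \<Longrightarrow> edg g \<in> elements poset"
  "g \<in> C \<Longrightarrow> fac g \<in> elements poset"
  by (auto simp: elements_poset)

lemma order_rel_poset_mem [simp]:
  "g \<in> C \<Longrightarrow> (vtx g, edg g) \<in> order_rel poset" "g \<in> C \<Longrightarrow> (edg g, fac g) \<in> order_rel poset"
  "g \<in> C \<Longrightarrow> (vtx g, fac g) \<in> order_rel poset"
  by (auto simp: poset_def)

text \<open>Incidence means having a common element, and the edge of \<open>h\<close> contains only
  h and abh.\<close>

lemma incident_vtx_edg:
  assumes "g \<in> C" "h \<in> C"
  shows "incident poset (vtx g) (edg h) \<longleftrightarrow> vtx g = vtx h \<or> vtx g = vtx (inv a \<otimes> h)"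
proof -
  have "incident poset (vtx g) (edg h) \<longleftrightarrow> (\<exists>k\<in>C. vtx g = vtx k \<and> edg h = edg k)"
    by (auto simp: incident_def poset_def)
  also have "\<dots> \<longleftrightarrow> vtx g = vtx h \<or> vtx g = vtx (inv a \<otimes> h)"
    using assms by (auto simp: edg_eq_iff vtx_twist [symmetric])
  finally show ?thesis .
qed

lemma incident_edg_fac:
  assumes "g \<in> C" "h \<in> C"
  shows "incident poset (edg h) (fac g) \<longleftrightarrow> fac g = fac h \<or> fac g = fac (b \<otimes> h)"
proof -
  have "incident poset (edg h) (fac g) \<longleftrightarrow> (\<exists>k\<in>C. fac g = fac k \<and> edg h = edg k)"
    by (auto simp: incident_def poset_def)
  also have "\<dots> \<longleftrightarrow> fac g = fac h \<or> fac g = fac (b \<otimes> h)"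
    using assms by (auto simp: edg_eq_iff intro: bexI[of _ "a \<otimes> (b \<otimes> h)"])
  finally show ?thesis .
qed

lemma incident_vtx_fac:
  assumes "g \<in> C" "h \<in> C"
  shows "incident poset (vtx g) (fac h)"
proof -
  obtain i j :: nat where "vtx (b [^] j \<otimes> g) = vtx g" "fac (b [^] j \<otimes> g) = fac h"
    using common_flag[OF assms] .
  then show ?thesis
    using order_rel_poset_mem(3)[of "b [^] j \<otimes> g"] assms by (simp add: incident_def)
qed

lemma incident_edg_vtx:
  "g \<in> C \<Longrightarrow> h \<in> C \<Longrightarrow>
    incident poset (edg h) (vtx g) \<longleftrightarrow> vtx g = vtx h \<or> vtx g = vtx (inv a \<otimes> h)"
  by (subst incident_commute) (rule incident_vtx_edg)

lemma incident_fac_edg: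
  "g \<in> C \<Longrightarrow> h \<in> C \<Longrightarrow>
    incident poset (fac g) (edg h) \<longleftrightarrow> fac g = fac h \<or> fac g = fac (b \<otimes> h)"
  by (subst incident_commute) (rule incident_edg_fac)

lemma incident_fac_vtx: "g \<in> C \<Longrightarrow> h \<in> C \<Longrightarrow> incident poset (fac h) (vtx g)"
  by (subst incident_commute) (rule incident_vtx_fac)

lemmas incidence =
  incident_vtx_edg incident_edg_vtx incident_edg_fac incident_fac_edg incident_vtx_fac incident_fac_vtx

section \<open>The axioms of a polyhedron\<close>

lemma partial_order_poset: "partial_order_on (elements poset) (order_rel poset)"
proof -
  have "trans (order_rel poset)"
  proof (rule transI)
    fix x y z assume xy: "(x, y) \<in> order_rel poset" and yz: "(y, z) \<in> order_rel poset"
    show "(x, z) \<in> order_rel poset"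
    proof (cases "x = y \<or> y = z")
      case True
      then show ?thesis using xy yz by auto
    next
      case False
      \<comment> \<open>The only chain of distinct elements is vertex, edge, face, and its end pair
        is related because every vertex meets every face.\<close>
      then obtain g h where "g \<in> C" "h \<in> C" "x = vtx g" "z = fac h"
        using xy yz by (auto simp: poset_def)
      then show ?thesis
        using incident_vtx_fac[of g h] by (auto simp: incident_def poset_def)
    qed
  qed
  moreover have "antisym (order_rel poset)"
    by (rule antisymI) (auto simp: poset_def)
  moreover have "refl_on (elements poset) (order_rel poset)"
    by (auto simp: refl_on_def poset_def)
  moreover have "order_rel poset \<subseteq> elements poset \<times> elements poset"
    by (auto simp: poset_def)
  ultimately show ?thesis
    by (simp add: partial_order_on_def preorder_on_def)
qed

lemma rank_poset: "rank poset x = x mod 3"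
  by (simp add: poset_def)

lemma order_rel_rank:
  assumes "(x, y) \<in> order_rel poset" "x \<noteq> y"
  shows "rank poset x < rank poset y"
  using assms by (auto simp: poset_def)

lemma edges_at_vtx:
  assumes "g \<in> C"
  shows "{y \<in> edges poset. incident poset y (vtx g)} = (\<lambda>k::int. edg (b [^] k \<otimes> g)) ` UNIV"
proof (intro equalityI subsetI)
  fix y assume "y \<in> {y \<in> edges poset. incident poset y (vtx g)}"
  then obtain h where h: "h \<in> C" "y = edg h" "vtx g = vtx h \<or> vtx g = vtx (inv a \<otimes> h)"
    using assms by (auto simp: incidence)
  \<comment> \<open>The edge has the two representatives \<open>h\<close> and abh; one lying in the
    coset of \<open>vtx g\<close> is taken.\<close>
  define h' where "h' = (if vtx g = vtx h then h else a \<otimes> (b \<otimes> h))"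
  have "h' \<in> C" "edg h' = y" "vtx g = vtx h'"
    using h by (auto simp: h'_def vtx_twist)
  moreover from this obtain k :: int where "h' = b [^] k \<otimes> g"
    using vtx_eq_iff assms by auto
  ultimately show "y \<in> (\<lambda>k::int. edg (b [^] k \<otimes> g)) ` UNIV" by auto
next
  fix y assume "y \<in> (\<lambda>k::int. edg (b [^] k \<otimes> g)) ` UNIV"
  then show "y \<in> {y \<in> edges poset. incident poset y (vtx g)}"
    using assms by (auto simp: incidence vtx_pow)
qed

lemma edges_at_fac:
  assumes "g \<in> C"
  shows "{y \<in> edges poset. incident poset y (fac g)} = (\<lambda>k::int. edg (a [^] k \<otimes> g)) ` UNIV"
proof (intro equalityI subsetI)
  fix y assume "y \<in> {y \<in> edges poset. incident poset y (fac g)}"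
  then obtain h where h: "h \<in> C" "y = edg h" "fac g = fac h \<or> fac g = fac (b \<otimes> h)"
    using assms by (auto simp: incident_edg_fac)
  define h' where "h' = (if fac g = fac h then h else a \<otimes> (b \<otimes> h))"
  have "h' \<in> C" "edg h' = y" "fac g = fac h'"
    using h by (auto simp: h'_def)
  moreover from this obtain k :: int where "h' = a [^] k \<otimes> g"
    using fac_eq_iff assms by auto
  ultimately show "y \<in> (\<lambda>k::int. edg (a [^] k \<otimes> g)) ` UNIV" by auto
next
  fix y assume "y \<in> (\<lambda>k::int. edg (a [^] k \<otimes> g)) ` UNIV"
  then show "y \<in> {y \<in> edges poset. incident poset y (fac g)}"
    using assms by (auto simp: incident_edg_fac fac_pow)
qed

text \<open>An edge at the vertex has a representative b^k g. Being on the face of \<open>g\<close>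
  forces b^k g = g or b^(k+1) g = g by \<open>vtx_fac_inj\<close>; the twist turns the second case
  into the edge of ag.\<close>

lemma edges_at_vtx_fac:
  assumes g: "g \<in> C"
  shows "{y \<in> edges poset. incident poset y (vtx g) \<and> incident poset y (fac g)} =
    {edg g, edg (a \<otimes> g)}"
proof (intro equalityI subsetI)
  fix y assume "y \<in> {y \<in> edges poset. incident poset y (vtx g) \<and> incident poset y (fac g)}"
  then have "y \<in> {y \<in> edges poset. incident poset y (vtx g)}" "incident poset y (fac g)"
    by auto
  then obtain k :: int where k: "y = edg (b [^] k \<otimes> g)" "incident poset y (fac g)"
    unfolding edges_at_vtx[OF g] by auto
  let ?h = "b [^] k \<otimes> g"
  have h: "?h \<in> C" "vtx ?h = vtx g" using g by (simp_all add: vtx_pow)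
  from k h have "fac g = fac ?h \<or> fac g = fac (b \<otimes> ?h)"
    using incident_edg_fac[of g ?h] g by simp
  then have "?h = g \<or> b \<otimes> ?h = g"
    using vtx_fac_inj[of ?h g] vtx_fac_inj[of "b \<otimes> ?h" g] g h by fastforce
  moreover have "edg ?h = edg (a \<otimes> (b \<otimes> ?h))" using h by simp
  ultimately show "y \<in> {edg g, edg (a \<otimes> g)}" using k by auto
next
  fix y assume "y \<in> {edg g, edg (a \<otimes> g)}"
  then show "y \<in> {y \<in> edges poset. incident poset y (vtx g) \<and> incident poset y (fac g)}"
    using g by (auto simp: incidence)
qed

lemma vertices_at_edg:
  "g \<in> C \<Longrightarrow> {x \<in> vertices poset. incident poset (edg g) x} = {vtx g, vtx (inv a \<otimes> g)}"
  by (auto simp: incidence)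

lemma faces_at_edg:
  "g \<in> C \<Longrightarrow> {x \<in> faces poset. incident poset (edg g) x} = {fac g, fac (b \<otimes> g)}"
  by (auto simp: incidence)

text \<open>Two incidences suffice: every face contains the base vertex, and every vertex or edge
  lies on a face.\<close>

lemma connected_poset: "incidence_connected poset (elements poset)"
proof (rule incidence_connectedI)
  show "vtx \<one> \<in> elements poset" by simp
next
  let ?r = "{(x, y). x \<in> elements poset \<and> y \<in> elements poset \<and> incident poset x y}"
  fix x assume x: "x \<in> elements poset"
  have f: "(vtx \<one>, fac g) \<in> ?r" if "g \<in> C" for g
    using that by (simp add: incidence)
  have v: "(fac g, vtx g) \<in> ?r" if "g \<in> C" for g
    using that by (simp add: incidence)
  have e: "(fac g, edg g) \<in> ?r" if "g \<in> C" for g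
    using that by (simp add: incidence)
  from x obtain g where "g \<in> C" and "x = vtx g \<or> x = edg g \<or> x = fac g"
    by (auto simp: elements_poset)
  then show "(vtx \<one>, x) \<in> ?r\<^sup>*"
    using f v e by (metis (no_types, lifting) r_into_rtrancl rtrancl.rtrancl_into_rtrancl)
qed

lemma neighbours_vtx:
  assumes "g \<in> C"
  shows "neighbours poset (vtx g) = {edg h | h. h \<in> C \<and> vtx h = vtx g} \<union> fac ` C"
proof -
  have "incident poset (vtx g) (edg h) \<longleftrightarrow> (\<exists>k\<in>C. edg h = edg k \<and> vtx k = vtx g)"
    if "h \<in> C" for h
    using assms that by (auto simp: incidence edg_eq_iff vtx_twist)
  moreover have "vtx h = vtx g" if "incident poset (vtx g) (vtx h)" for h
    using that by (auto simp: incident_def poset_def)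
  ultimately show ?thesis
    using assms by (auto simp: neighbours_def elements_poset incidence)
qed

lemma neighbours_fac:
  assumes "g \<in> C"
  shows "neighbours poset (fac g) = {edg h | h. h \<in> C \<and> fac h = fac g} \<union> vtx ` C"
proof -
  have "incident poset (fac g) (edg h) \<longleftrightarrow> (\<exists>k\<in>C. edg h = edg k \<and> fac k = fac g)"
    if "h \<in> C" for h
    using assms that by (auto simp: incidence edg_eq_iff intro: bexI[of _ "a \<otimes> (b \<otimes> h)"])
  moreover have "fac h = fac g" if "incident poset (fac g) (fac h)" for h
    using that by (auto simp: incident_def poset_def)
  ultimately show ?thesis
    using assms by (auto simp: neighbours_def elements_poset incidence)
qed

text \<open>Around the vertex of \<open>g\<close> one walks from face to face across the edges of g,
  bg, b^2 g and so on; by \<open>common_flag\<close> this walk visits every face.\<close>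

lemma connected_neighbours_vtx:
  assumes g: "g \<in> C"
  shows "incidence_connected poset (neighbours poset (vtx g))"
proof (rule incidence_connectedI)
  show "fac g \<in> neighbours poset (vtx g)" using g by (simp add: neighbours_vtx)
next
  let ?S = "neighbours poset (vtx g)"
  let ?r = "{(x, y). x \<in> ?S \<and> y \<in> ?S \<and> incident poset x y}"
  fix x assume x: "x \<in> ?S"
  have e: "(fac h, edg h) \<in> ?r" "(edg h, fac (b \<otimes> h)) \<in> ?r" if "h \<in> C" "vtx h = vtx g" for h
    using that g by (auto simp: incidence neighbours_vtx)
  have v: "vtx (b [^] (j :: nat) \<otimes> g) = vtx g" for j
    using vtx_pow[of g "int j"] g by (simp add: int_pow_int)
  have step: "(fac g, fac (b [^] (j :: nat) \<otimes> g)) \<in> ?r\<^sup>*" for j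
  proof (induction j)
    case 0
    then show ?case using g by simp
  next
    case (Suc j)
    have "b [^] Suc j \<otimes> g = b \<otimes> (b [^] j \<otimes> g)"
      using g by (metis b_closed m_assoc nat_pow_Suc2 nat_pow_closed)
    then show ?case
      using Suc e[of "b [^] j \<otimes> g"] v[of j] g
      by (metis (no_types, lifting) b_closed m_closed nat_pow_closed rtrancl.rtrancl_into_rtrancl)
  qed
  have f: "(fac g, fac h) \<in> ?r\<^sup>*" if h: "h \<in> C" for h
  proof -
    obtain i j :: nat where "fac (b [^] j \<otimes> g) = fac h"
      using common_flag[OF g h] .
    then show ?thesis using step[of j] by simp
  qed
  from x consider h where "h \<in> C" "vtx h = vtx g" "x = edg h" | h where "h \<in> C" "x = fac h"
    using g by (auto simp: neighbours_vtx)
  then show "(fac g, x) \<in> ?r\<^sup>*"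
  proof cases
    case 1
    then show ?thesis using f e(1) by (metis (no_types, lifting) rtrancl.rtrancl_into_rtrancl)
  next
    case 2
    then show ?thesis using f by simp
  qed
qed

text \<open>The dual walk around a face uses a^-1, because the far end of the edge of
  \<open>h\<close> is the vertex of a^-1 h.\<close>

lemma connected_neighbours_fac:
  assumes g: "g \<in> C"
  shows "incidence_connected poset (neighbours poset (fac g))"
proof (rule incidence_connectedI)
  show "vtx g \<in> neighbours poset (fac g)" using g by (simp add: neighbours_fac)
next
  let ?S = "neighbours poset (fac g)"
  let ?r = "{(x, y). x \<in> ?S \<and> y \<in> ?S \<and> incident poset x y}"
  fix x assume x: "x \<in> ?S"
  have e: "(vtx h, edg h) \<in> ?r" "(edg h, vtx (inv a \<otimes> h)) \<in> ?r" if "h \<in> C" "fac h = fac g" for h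
    using that g by (auto simp: incidence neighbours_fac)
  have v: "fac (inv (a [^] (j :: nat)) \<otimes> g) = fac g" for j
    using fac_pow[of g "- int j"] g by (simp add: int_pow_neg_int)
  have step: "(vtx g, vtx (inv (a [^] (j :: nat)) \<otimes> g)) \<in> ?r\<^sup>*" for j
  proof (induction j)
    case 0
    then show ?case using g by simp
  next
    case (Suc j)
    have "inv (a [^] Suc j) \<otimes> g = inv a \<otimes> (inv (a [^] j) \<otimes> g)"
      using g by (simp add: inv_mult_group m_assoc)
    then show ?case
      using Suc e[of "inv (a [^] j) \<otimes> g"] v[of j] g
      by (metis (no_types, lifting) a_closed inv_closed m_closed nat_pow_closed rtrancl.rtrancl_into_rtrancl)
  qed
  have f: "(vtx g, vtx h) \<in> ?r\<^sup>*" if h: "h \<in> C" for h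
  proof -
    \<comment> \<open>Here \<open>common_flag\<close> is applied with \<open>h\<close> and
      \<open>g\<close> exchanged, so that the vertex of \<open>h\<close> is also that of a^-i g, a
      point of the walk.\<close>
    obtain i j :: nat where ij: "b [^] j \<otimes> h = inv (a [^] i) \<otimes> g" "vtx (b [^] j \<otimes> h) = vtx h"
      using common_flag[OF h g] .
    then show ?thesis
      using step[of i] by simp
  qed
  from x consider h where "h \<in> C" "fac h = fac g" "x = edg h" | h where "h \<in> C" "x = vtx h"
    using g by (auto simp: neighbours_fac)
  then show "(vtx g, x) \<in> ?r\<^sup>*"
  proof cases
    case 1
    then show ?thesis using f e(1) by (metis (no_types, lifting) rtrancl.rtrancl_into_rtrancl)
  next
    case 2
    then show ?thesis using f by simp
  qed
qed

lemma polyhedron_poset: "polyhedron poset"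
  unfolding polyhedron_def
proof (intro conjI ballI impI)
  show "partial_order_on (elements poset) (order_rel poset)" by (rule partial_order_poset)
  show "rank poset x \<in> {0, 1, 2}" if "x \<in> elements poset" for x
    using that by (auto simp: elements_poset rank_poset)
  show "case z of (x, y) \<Rightarrow> x \<noteq> y \<longrightarrow> rank poset x < rank poset y" if "z \<in> order_rel poset" for z
    using that order_rel_rank by auto
  show "card {v \<in> vertices poset. incident poset y v} = 2" if "y \<in> edges poset" for y
    using that by (auto simp: vertices_at_edg simp del: of_rank_poset(1))
  show "card {f \<in> faces poset. incident poset y f} = 2" if "y \<in> edges poset" for y
    using that by (auto simp: faces_at_edg simp del: of_rank_poset(4))
  show "card {y \<in> edges poset. incident poset y v \<and> incident poset y f} = 2"
    if vf: "v \<in> vertices poset" "f \<in> faces poset" for v f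
  proof -
    obtain g h where gh: "g \<in> C" "h \<in> C" "v = vtx g" "f = fac h" using vf by auto
    \<comment> \<open>A single element representing both the vertex and the face reduces the count
      to \<open>edges_at_vtx_fac\<close>.\<close>
    then obtain k where "k \<in> C" "vtx k = v" "fac k = f"
      using common_flag[of g h] by (metis b_closed m_closed nat_pow_closed)
    then show ?thesis using edges_at_vtx_fac[of k] by auto
  qed
  show "incidence_connected poset (elements poset)" by (rule connected_poset)
  show "incidence_connected poset (neighbours poset x)" if "x \<in> vertices poset \<union> faces poset" for x
    using that connected_neighbours_vtx connected_neighbours_fac by auto
qed

section \<open>Orders of the generators and the type\<close>

lemma int_pow_mod:
  assumes "x \<in> C" shows "x [^] ((k :: int) mod int (ord x)) = x [^] k"
proof -
  have "int (ord x) dvd k - k mod int (ord x)" by simp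
  then show ?thesis using assms by (simp add: int_pow_eq)
qed

lemma range_int_pow:
  assumes "x \<in> C"
  shows "(\<lambda>k::int. h (x [^] k)) ` UNIV = (\<lambda>k::int. h (x [^] k)) ` {0..<int (ord x)}"
proof -
  have "h (x [^] k) \<in> (\<lambda>k::int. h (x [^] k)) ` {0..<int (ord x)}" for k :: int
  proof
    show "h (x [^] k) = h (x [^] (k mod int (ord x)))" using assms by (simp add: int_pow_mod)
    show "k mod int (ord x) \<in> {0..<int (ord x)}"
      using ord_ge_1[OF finite_carrier assms] by simp
  qed
  then show ?thesis by auto
qed

lemma int_pow_inj:
  assumes "x \<in> C" shows "inj_on (\<lambda>k::int. x [^] k) {0..<int (ord x)}"
proof (rule inj_onI)
  fix k l assume kl: "k \<in> {0..<int (ord x)}" "l \<in> {0..<int (ord x)}" "x [^] k = x [^] l"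
  then have "int (ord x) dvd l - k" using assms by (simp add: int_pow_eq)
  moreover have "\<bar>l - k\<bar> < int (ord x)" using kl by auto
  ultimately show "k = l" using dvd_imp_le_int[of "l - k" "int (ord x)"] by auto
qed

lemma has_type_poset: "has_type poset (ord a) (ord b)"
proof -
  have "card {y \<in> edges poset. incident poset y (fac g)} = ord a" if g: "g \<in> C" for g
  proof -
    have "inj_on (\<lambda>k::int. edg (a [^] k \<otimes> g)) {0..<int (ord a)}"
    proof (rule inj_onI)
      fix k l assume kl: "k \<in> {0..<int (ord a)}" "l \<in> {0..<int (ord a)}"
        "edg (a [^] k \<otimes> g) = edg (a [^] l \<otimes> g)"
      let ?h = "a [^] k \<otimes> g"
      have h: "?h \<in> C" "fac ?h = fac g" "fac (a [^] l \<otimes> g) = fac g"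
        using g by (simp_all add: fac_pow)
      \<comment> \<open>The second representative of the edge of \<open>?h\<close> lies on the face
        of b\<open>?h\<close>, which is not the face of \<open>?h\<close>; so distinct powers of
        \<open>a\<close> give distinct edges.\<close>
      then have "a [^] l \<otimes> g \<noteq> a \<otimes> (b \<otimes> ?h)"
        using fac_b_neq[of ?h] by auto
      then have "a [^] k = a [^] l" using kl g h by (auto simp: edg_eq_iff)
      then show "k = l" using kl inj_onD[OF int_pow_inj[of a]] by blast
    qed
    then show ?thesis
      using range_int_pow[of a "\<lambda>x. edg (x \<otimes> g)"] edges_at_fac[OF g] by (simp add: card_image)
  qed
  moreover have "card {y \<in> edges poset. incident poset y (vtx g)} = ord b" if g: "g \<in> C" for g
  proof -
    have "inj_on (\<lambda>k::int. edg (b [^] k \<otimes> g)) {0..<int (ord b)}"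
    proof (rule inj_onI)
      fix k l assume kl: "k \<in> {0..<int (ord b)}" "l \<in> {0..<int (ord b)}"
        "edg (b [^] k \<otimes> g) = edg (b [^] l \<otimes> g)"
      let ?h = "b [^] k \<otimes> g"
      have h: "?h \<in> C" "vtx ?h = vtx g" "vtx (b [^] l \<otimes> g) = vtx g"
        using g by (simp_all add: vtx_pow)
      then have "b [^] l \<otimes> g \<noteq> a \<otimes> (b \<otimes> ?h)"
        using vtx_inv_a_neq[of ?h] vtx_twist[of ?h] by metis
      then have "b [^] k = b [^] l" using kl g h by (auto simp: edg_eq_iff)
      then show "k = l" using kl inj_onD[OF int_pow_inj[of b]] by blast
    qed
    then show ?thesis
      using range_int_pow[of b "\<lambda>x. edg (x \<otimes> g)"] edges_at_vtx[OF g] by (simp add: card_image)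
  qed
  ultimately show ?thesis by (auto simp: has_type_def)
qed

section \<open>Flags and tightness\<close>

definition flag_of :: "'a \<Rightarrow> nat flag" where
  "flag_of g = (vtx g, edg g, fac g)"

text \<open>It shares vertex and face with \<open>flag_of g\<close> but uses the other of the two
  edges found in \<open>edges_at_vtx_fac\<close>.\<close>

definition coflag_of :: "'a \<Rightarrow> nat flag" where
  "coflag_of g = (vtx g, edg (a \<otimes> g), fac g)"

text \<open>A fixed edge offers two vertices and two faces; of the four combinations two have the
  form \<open>flag_of\<close> and two the form \<open>coflag_of\<close>.\<close>

lemma flags_poset: "flags poset = flag_of ` C \<union> coflag_of ` C"
proof (intro equalityI subsetI)
  fix \<Psi> assume "\<Psi> \<in> flags poset"
  then obtain x h z where \<Psi>: "\<Psi> = (x, edg h, z)" and h: "h \<in> C"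
    and x: "x = vtx h \<or> x = vtx (inv a \<otimes> h)" and z: "z = fac h \<or> z = fac (b \<otimes> h)"
    by (auto simp: flags_def incidence)
  have "(vtx h, edg h, fac h) = flag_of h"
    "(vtx h, edg h, fac (b \<otimes> h)) = coflag_of (b \<otimes> h)"
    "(vtx (inv a \<otimes> h), edg h, fac h) = coflag_of (inv a \<otimes> h)"
    "(vtx (inv a \<otimes> h), edg h, fac (b \<otimes> h)) = flag_of (a \<otimes> (b \<otimes> h))"
    using h by (simp_all add: flag_of_def coflag_of_def vtx_twist)
  then show "\<Psi> \<in> flag_of ` C \<union> coflag_of ` C"
    using x z h by (auto simp: \<Psi>)
next
  fix \<Psi> assume "\<Psi> \<in> flag_of ` C \<union> coflag_of ` C"
  then show "\<Psi> \<in> flags poset"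
    by (auto simp: flags_def flag_of_def coflag_of_def incidence)
qed

lemma flag_of_mem [simp]: "g \<in> C \<Longrightarrow> flag_of g \<in> flags poset" "g \<in> C \<Longrightarrow> coflag_of g \<in> flags poset"
  by (auto simp: flags_poset)

lemma flag_of_eq_iff [simp]:
  assumes "g \<in> C" "h \<in> C"
  shows "flag_of g = flag_of h \<longleftrightarrow> g = h" "coflag_of g = coflag_of h \<longleftrightarrow> g = h"
    "flag_of g \<noteq> coflag_of h" "coflag_of h \<noteq> flag_of g"
proof -
  show "flag_of g = flag_of h \<longleftrightarrow> g = h" "coflag_of g = coflag_of h \<longleftrightarrow> g = h"
    using vtx_fac_inj[OF assms] by (auto simp: flag_of_def coflag_of_def)
  show "flag_of g \<noteq> coflag_of h"
    using vtx_fac_inj[OF assms] edg_a_neq assms by (auto simp: flag_of_def coflag_of_def)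
  then show "coflag_of h \<noteq> flag_of g" by simp
qed

lemma card_flags_poset: "card (flags poset) = 2 * card C"
proof -
  have "card (flags poset) = card (flag_of ` C) + card (coflag_of ` C)"
    unfolding flags_poset using finite_carrier by (intro card_Un_disjoint) auto
  also have "\<dots> = card C + card C"
    by (simp add: card_image inj_on_def)
  finally show ?thesis by simp
qed

text \<open>The factorisation makes (i, j) -> a^i b^j surjective, and the trivial intersection makes
  it injective on reduced exponents.\<close>

lemma card_carrier: "card C = ord a * ord b"
proof -
  let ?D = "{0..<int (ord a)} \<times> {0..<int (ord b)}"
  have "inj_on (\<lambda>(i, j). a [^] i \<otimes> b [^] j) ?D"
  proof (rule inj_onI, clarify)
    fix i j k l assume ik: "i \<in> {0..<int (ord a)}" "k \<in> {0..<int (ord a)}"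
      and jl: "j \<in> {0..<int (ord b)}" "l \<in> {0..<int (ord b)}"
      and eq: "a [^] i \<otimes> b [^] j = a [^] k \<otimes> b [^] l"
    have "a [^] (i - k) = b [^] (l - j)"
    proof -
      have "a [^] (i - k) = inv (a [^] k) \<otimes> a [^] i"
        using int_pow_mult[of a "- k" i] by (simp add: int_pow_neg)
      also have "\<dots> = inv (a [^] k) \<otimes> (a [^] i \<otimes> b [^] j) \<otimes> inv (b [^] j)"
        by (simp add: m_assoc)
      also have "\<dots> = b [^] l \<otimes> inv (b [^] j)"
        by (simp add: eq)
      also have "\<dots> = b [^] (l - j)"
        using int_pow_mult[of b l "- j"] by (simp add: int_pow_neg)
      finally show ?thesis .
    qed
    then have "a [^] (i - k) = \<one>" "b [^] (l - j) = \<one>"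
      using trivial_intersection by metis+
    then have "a [^] k = a [^] i" "b [^] j = b [^] l"
      by (simp_all add: int_pow_eq int_pow_eq_id)
    then show "i = k \<and> j = l"
      using ik jl inj_onD[OF int_pow_inj[of a]] inj_onD[OF int_pow_inj[of b]] by (metis a_closed b_closed)
  qed
  moreover have "(\<lambda>(i, j). a [^] i \<otimes> b [^] j) ` ?D = C"
  proof (intro equalityI subsetI)
    fix x assume "x \<in> C"
    then obtain i j :: nat where x: "x = a [^] i \<otimes> b [^] j" using factorisation by blast
    have "x = (\<lambda>(i, j). a [^] i \<otimes> b [^] j) (int i mod int (ord a), int j mod int (ord b))"
      by (simp add: x int_pow_mod int_pow_int)
    then show "x \<in> (\<lambda>(i, j). a [^] i \<otimes> b [^] j) ` ?D"
      using ord_ge_1[OF finite_carrier a_closed] ord_ge_1[OF finite_carrier b_closed]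
      by (intro image_eqI[of _ _ "(int i mod int (ord a), int j mod int (ord b))"]) auto
  qed auto
  ultimately have "card C = card ?D" by (metis card_image)
  then show ?thesis by simp
qed

lemma tight_poset: "tight poset (ord a) (ord b)"
  by (simp add: tight_def has_type_poset card_flags_poset card_carrier)

end

section \<open>Adjacent flags in an arbitrary polyhedron\<close>

definition adjacent_at :: "nat \<Rightarrow> 'a flag \<Rightarrow> 'a flag \<Rightarrow> bool" where
  "adjacent_at i \<Phi> \<Psi> \<longleftrightarrow> (\<forall>j\<in>{0, 1, 2}. flag_elem \<Psi> j \<noteq> flag_elem \<Phi> j \<longleftrightarrow> j = i)"

lemma card_2_unique_other:
  assumes "card S = 2" "x \<in> S" "y \<in> S" "z \<in> S" "y \<noteq> x" "z \<noteq> x"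
  shows "y = z"
  using assms by (auto simp: card_2_iff)

text \<open>The other two entries of a flag leave exactly two candidates for entry \<open>i\<close>,
  by the axiom on edges for \<open>i = 0\<close> and \<open>i = 2\<close> and by that on vertex-face
  pairs for \<open>i = 1\<close>.\<close>

lemma adjacent_unique:
  assumes P: "polyhedron P" and "\<Phi> \<in> flags P" "\<Psi> \<in> flags P" "\<Psi>' \<in> flags P" "i \<in> {0, 1, 2}"
    and adj: "adjacent_at i \<Phi> \<Psi>" "adjacent_at i \<Phi> \<Psi>'"
  shows "\<Psi> = \<Psi>'"
proof -
  obtain x y z where \<Phi>: "\<Phi> = (x, y, z)" by (cases \<Phi>)
  obtain x1 y1 z1 where \<Psi>: "\<Psi> = (x1, y1, z1)" by (cases \<Psi>)
  obtain x2 y2 z2 where \<Psi>': "\<Psi>' = (x2, y2, z2)" by (cases \<Psi>')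
  note fl = assms(2-4)[unfolded \<Phi> \<Psi> \<Psi>' flags_def, simplified]
  consider "i = 0" | "i = 1" | "i = 2" using \<open>i \<in> {0, 1, 2}\<close> by auto
  then show ?thesis
  proof cases
    case 1
    then have eq: "y1 = y" "z1 = z" "y2 = y" "z2 = z" "x1 \<noteq> x" "x2 \<noteq> x"
      using adj by (auto simp: adjacent_at_def \<Phi> \<Psi> \<Psi>')
    have "card {v \<in> vertices P. incident P y v} = 2" using P fl by (auto simp: polyhedron_def)
    then have "x1 = x2"
      by (rule card_2_unique_other[of _ x]) (use fl eq in \<open>auto simp: incident_commute[of P y]\<close>)
    then show ?thesis using eq by (simp add: \<Psi> \<Psi>')
  next
    case 2
    then have eq: "x1 = x" "z1 = z" "x2 = x" "z2 = z" "y1 \<noteq> y" "y2 \<noteq> y"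
      using adj by (auto simp: adjacent_at_def \<Phi> \<Psi> \<Psi>')
    have "card {e \<in> edges P. incident P e x \<and> incident P e z} = 2"
      using P fl by (auto simp: polyhedron_def)
    then have "y1 = y2"
      by (rule card_2_unique_other[of _ y]) (use fl eq in \<open>auto simp: incident_commute[of P _ x]\<close>)
    then show ?thesis using eq by (simp add: \<Psi> \<Psi>')
  next
    case 3
    then have eq: "x1 = x" "y1 = y" "x2 = x" "y2 = y" "z1 \<noteq> z" "z2 \<noteq> z"
      using adj by (auto simp: adjacent_at_def \<Phi> \<Psi> \<Psi>')
    have "card {f \<in> faces P. incident P y f} = 2" using P fl by (auto simp: polyhedron_def)
    then have "z1 = z2"
      by (rule card_2_unique_other[of _ z]) (use fl eq in auto)
    then show ?thesis using eq by (simp add: \<Psi> \<Psi>')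
  qed
qed

lemma adj_flag_eqI:
  assumes "polyhedron P" "\<Phi> \<in> flags P" "\<Psi> \<in> flags P" "i \<in> {0, 1, 2}" "adjacent_at i \<Phi> \<Psi>"
  shows "adj_flag P i \<Phi> = \<Psi>"
  unfolding adj_flag_def adjacent_at_def[symmetric]
  using assms adjacent_unique by (intro the_equality) blast+

lemma automorphism_mem:
  assumes "\<gamma> \<in> automorphisms P" "x \<in> elements P"
  shows "\<gamma> x \<in> elements P"
  using assms by (auto simp: automorphisms_def dest: Bij_imp_funcset)

lemma automorphism_eq_iff:
  assumes "\<gamma> \<in> automorphisms P" "x \<in> elements P" "y \<in> elements P"
  shows "\<gamma> x = \<gamma> y \<longleftrightarrow> x = y"
  using assms by (auto simp: automorphisms_def Bij_def bij_betw_def inj_on_eq_iff)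

text \<open>Automorphisms are defined by the order alone. The image of a flag is a chain whose ranks
  increase strictly within {0, 1, 2}, so they must be 0, 1, 2.\<close>

lemma act_flag:
  assumes P: "polyhedron P" and \<gamma>: "\<gamma> \<in> automorphisms P" and \<Phi>: "\<Phi> \<in> flags P"
  shows "act \<gamma> \<Phi> \<in> flags P"
proof -
  obtain x y z where xyz: "\<Phi> = (x, y, z)" by (cases \<Phi>)
  have el: "x \<in> elements P" "y \<in> elements P" "z \<in> elements P"
    and rk: "rank P x = 0" "rank P y = 1" "rank P z = 2"
    and inc: "incident P x y" "incident P y z" "incident P x z"
    using \<Phi> by (auto simp: xyz flags_def of_rank_def)
  have mono: "rank P u < rank P w" if "(u, w) \<in> order_rel P" "u \<noteq> w" for u w
    using P that by (auto simp: polyhedron_def)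
  have "(x, y) \<in> order_rel P" "(y, z) \<in> order_rel P" "(x, z) \<in> order_rel P"
    using inc rk mono[of y x] mono[of z y] mono[of z x] by (auto simp: incident_def)
  then have ord: "(\<gamma> x, \<gamma> y) \<in> order_rel P" "(\<gamma> y, \<gamma> z) \<in> order_rel P" "(\<gamma> x, \<gamma> z) \<in> order_rel P"
    using \<gamma> el by (auto simp: automorphisms_def)
  have el': "\<gamma> x \<in> elements P" "\<gamma> y \<in> elements P" "\<gamma> z \<in> elements P"
    using \<gamma> el by (simp_all add: automorphism_mem)
  have "\<gamma> x \<noteq> \<gamma> y" "\<gamma> y \<noteq> \<gamma> z"
    using el \<gamma> rk by (auto simp: automorphism_eq_iff)
  then have "rank P (\<gamma> x) < rank P (\<gamma> y)" "rank P (\<gamma> y) < rank P (\<gamma> z)"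
    using ord mono by auto
  moreover have "rank P (\<gamma> z) \<in> {0, 1, 2}"
    using P el' by (auto simp: polyhedron_def)
  ultimately have "rank P (\<gamma> x) = 0" "rank P (\<gamma> y) = 1" "rank P (\<gamma> z) = 2" by auto
  then show ?thesis
    using ord el' by (auto simp: xyz act_def flags_def of_rank_def incident_def)
qed

lemma adj_flag_act:
  assumes P: "polyhedron P" and \<gamma>: "\<gamma> \<in> automorphisms P" and fl: "\<Phi> \<in> flags P" "\<Psi> \<in> flags P"
    and i: "i \<in> {0, 1, 2}" and adj: "adjacent_at i \<Phi> \<Psi>"
  shows "adj_flag P i (act \<gamma> \<Phi>) = act \<gamma> \<Psi>"
proof (rule adj_flag_eqI)
  have "flag_elem \<Theta> j \<in> elements P" "flag_elem (act \<gamma> \<Theta>) j = \<gamma> (flag_elem \<Theta> j)"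
    if "\<Theta> \<in> flags P" for \<Theta> j
    using that by (auto simp: flags_def of_rank_def act_def)
  then show "adjacent_at i (act \<gamma> \<Phi>) (act \<gamma> \<Psi>)"
    using adj \<gamma> fl by (simp add: adjacent_at_def automorphism_eq_iff)
qed (use assms in \<open>simp_all add: act_flag\<close>)

section \<open>Group elements as automorphisms\<close>

context tight_rotation_group begin

lemma adjacent_flag_of:
  assumes "g \<in> C"
  shows "adjacent_at 0 (flag_of g) (coflag_of (inv a \<otimes> g))"
    "adjacent_at (Suc 0) (flag_of g) (coflag_of g)"
    "adjacent_at 2 (flag_of g) (coflag_of (b \<otimes> g))"
    "adjacent_at 0 (coflag_of g) (flag_of (a \<otimes> g))"
    "adjacent_at (Suc 0) (coflag_of g) (flag_of g)"
    "adjacent_at 2 (coflag_of g) (flag_of (inv b \<otimes> g))"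
proof -
  have "edg (inv b \<otimes> g) = edg (a \<otimes> g)"
    using edg_twist[of "inv b \<otimes> g"] assms by simp
  moreover have "fac (inv b \<otimes> g) \<noteq> fac g"
    using fac_b_neq[of "inv b \<otimes> g"] assms by simp
  ultimately show "adjacent_at 2 (coflag_of g) (flag_of (inv b \<otimes> g))"
    using assms by (simp add: adjacent_at_def flag_of_def coflag_of_def)
qed (use assms in \<open>simp_all add: adjacent_at_def flag_of_def coflag_of_def\<close>)

text \<open>Two moves in succession multiply the group element on the left: 1 then 0 by
  \<open>a\<close> and 2 then 1 by \<open>b\<close> on \<open>flag_of\<close>, but by the inverse
  generators on \<open>coflag_of\<close>. This difference is the source of the inverting
  homomorphism.\<close>

lemma adj_flag_of:
  assumes "g \<in> C"
  shows "adj_flag poset 0 (flag_of g) = coflag_of (inv a \<otimes> g)"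
    "adj_flag poset (Suc 0) (flag_of g) = coflag_of g"
    "adj_flag poset 2 (flag_of g) = coflag_of (b \<otimes> g)"
    "adj_flag poset 0 (coflag_of g) = flag_of (a \<otimes> g)"
    "adj_flag poset (Suc 0) (coflag_of g) = flag_of g"
    "adj_flag poset 2 (coflag_of g) = flag_of (inv b \<otimes> g)"
  using adjacent_flag_of[OF assms] assms
  by (simp_all add: adj_flag_eqI[OF polyhedron_poset])

text \<open>Right multiplication on cosets, computed on a representative recovered from the label;
  \<open>label_mult_cong\<close> makes the choice harmless. The restriction to
  \<open>elements poset\<close> gives the extensionality that \<open>Bij\<close> demands.\<close>

definition rmul :: "'a \<Rightarrow> nat \<Rightarrow> nat" where
  "rmul k = (\<lambda>x\<in>elements poset.
    if x \<in> vtx ` C then vtx (inv_into C vtx x \<otimes> k)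
    else if x \<in> edg ` C then edg (inv_into C edg x \<otimes> k)
    else fac (inv_into C fac x \<otimes> k))"

lemma label_mult_cong:
  assumes "g \<in> C" "h \<in> C" "k \<in> C"
  shows "vtx g = vtx h \<Longrightarrow> vtx (g \<otimes> k) = vtx (h \<otimes> k)"
    "edg g = edg h \<Longrightarrow> edg (g \<otimes> k) = edg (h \<otimes> k)"
    "fac g = fac h \<Longrightarrow> fac (g \<otimes> k) = fac (h \<otimes> k)"
  using assms by (auto simp: vtx_eq_iff edg_eq_iff fac_eq_iff m_assoc)

lemma rmul_label [simp]:
  assumes "g \<in> C" "k \<in> C"
  shows "rmul k (vtx g) = vtx (g \<otimes> k)" "rmul k (edg g) = edg (g \<otimes> k)" "rmul k (fac g) = fac (g \<otimes> k)"
proof -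
  have inv_into: "inv_into C l (l g) \<in> C" "l (inv_into C l (l g)) = l g" for l :: "'a \<Rightarrow> nat"
    using assms by (simp_all add: inv_into_into f_inv_into_f)
  have "edg g \<notin> vtx ` C" "fac g \<notin> vtx ` C" "fac g \<notin> edg ` C" by auto
  then have rmul: "rmul k (vtx g) = vtx (inv_into C vtx (vtx g) \<otimes> k)"
    "rmul k (edg g) = edg (inv_into C edg (edg g) \<otimes> k)"
    "rmul k (fac g) = fac (inv_into C fac (fac g) \<otimes> k)"
    using assms by (simp_all add: rmul_def)
  show "rmul k (vtx g) = vtx (g \<otimes> k)" "rmul k (edg g) = edg (g \<otimes> k)"
    "rmul k (fac g) = fac (g \<otimes> k)"
    unfolding rmul by (rule label_mult_cong[OF inv_into(1) assms inv_into(2)])+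
qed

lemma elements_cases:
  assumes "x \<in> elements poset"
  obtains g where "g \<in> C" "x = vtx g" | g where "g \<in> C" "x = edg g" | g where "g \<in> C" "x = fac g"
  using assms by (auto simp: elements_poset)

lemma rmul_mem: "k \<in> C \<Longrightarrow> x \<in> elements poset \<Longrightarrow> rmul k x \<in> elements poset"
  by (erule elements_cases) simp_all

lemma rmul_rmul:
  "k \<in> C \<Longrightarrow> l \<in> C \<Longrightarrow> x \<in> elements poset \<Longrightarrow> rmul l (rmul k x) = rmul (k \<otimes> l) x"
  by (erule elements_cases) (simp_all add: m_assoc)

lemma rmul_one: "x \<in> elements poset \<Longrightarrow> rmul \<one> x = x"
  by (erule elements_cases) simp_all

lemma rmul_order:
  assumes "k \<in> C" "(x, y) \<in> order_rel poset"
  shows "(rmul k x, rmul k y) \<in> order_rel poset"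
proof -
  consider "x = y" "x \<in> elements poset" | g where "g \<in> C" "x = vtx g" "y = edg g"
    | g where "g \<in> C" "x = edg g" "y = fac g" | g where "g \<in> C" "x = vtx g" "y = fac g"
    using assms(2) by (auto simp: poset_def)
  then show ?thesis
  proof cases
    case 1
    then show ?thesis
      using partial_order_onD(1)[OF partial_order_poset] rmul_mem[OF assms(1)] by (auto dest: refl_onD)
  qed (use assms(1) in simp_all)
qed

lemma rmul_automorphism:
  assumes k: "k \<in> C"
  shows "rmul k \<in> automorphisms poset"
proof -
  have inv: "rmul (inv k) (rmul k x) = x" "rmul k (rmul (inv k) x) = x" if "x \<in> elements poset" for x
    using k that by (simp_all add: rmul_rmul rmul_one)
  have "bij_betw (rmul k) (elements poset) (elements poset)"
    using k inv rmul_mem by (intro bij_betw_byWitness[where f' = "rmul (inv k)"]) auto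
  then have "rmul k \<in> Bij (elements poset)"
    by (simp add: Bij_def rmul_def)
  moreover have "(x, y) \<in> order_rel poset \<longleftrightarrow> (rmul k x, rmul k y) \<in> order_rel poset"
    if "x \<in> elements poset" "y \<in> elements poset" for x y
    using rmul_order[OF k, of x y] rmul_order[of "inv k" "rmul k x" "rmul k y"] k inv that by auto
  ultimately show ?thesis by (simp add: automorphisms_def)
qed

lemma act_rmul [simp]:
  assumes "g \<in> C" "k \<in> C"
  shows "act (rmul k) (flag_of g) = flag_of (g \<otimes> k)" "act (rmul k) (coflag_of g) = coflag_of (g \<otimes> k)"
  using assms by (simp_all add: act_def flag_of_def coflag_of_def m_assoc)

text \<open>Left multiplications by \<open>a\<close> and \<open>b\<close> suffice, without inverses,
  since the exponents of the factorisation are natural numbers. They correspond to the rotations of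
  flags.\<close>

lemma carrier_induct [consumes 1, case_names one a b]:
  assumes "x \<in> C" and one: "Q \<one>"
    and a: "\<And>g. g \<in> C \<Longrightarrow> Q g \<Longrightarrow> Q (a \<otimes> g)" and b: "\<And>g. g \<in> C \<Longrightarrow> Q g \<Longrightarrow> Q (b \<otimes> g)"
  shows "Q x"
proof -
  obtain i j :: nat where x: "x = a [^] i \<otimes> b [^] j" using factorisation assms(1) by blast
  have "Q (b [^] j)"
    by (induction j) (use one b nat_pow_Suc2[OF b_closed] in auto)
  then have "Q (a [^] i \<otimes> b [^] j)"
  proof (induction i)
    case (Suc i)
    have "a [^] Suc i \<otimes> b [^] j = a \<otimes> (a [^] i \<otimes> b [^] j)"
      by (simp only: nat_pow_Suc2[OF a_closed] m_assoc a_closed b_closed nat_pow_closed)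
    then show ?case using Suc a by simp
  qed simp
  then show ?thesis by (simp add: x)
qed

text \<open>Automorphisms commute with adjacency, so left multiplication of the argument becomes a
  rotation of the image flag.\<close>

lemma act_rotation:
  assumes \<gamma>: "\<gamma> \<in> automorphisms poset" and g: "g \<in> C"
  shows "act \<gamma> (flag_of (a \<otimes> g)) = adj_flag poset 0 (adj_flag poset 1 (act \<gamma> (flag_of g)))"
    "act \<gamma> (flag_of (b \<otimes> g)) = adj_flag poset 1 (adj_flag poset 2 (act \<gamma> (flag_of g)))"
proof -
  note adj = adj_flag_act[OF polyhedron_poset \<gamma>]
  have "adj_flag poset 1 (act \<gamma> (flag_of g)) = act \<gamma> (coflag_of g)"
    "adj_flag poset 0 (act \<gamma> (coflag_of g)) = act \<gamma> (flag_of (a \<otimes> g))"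
    "adj_flag poset 2 (act \<gamma> (flag_of g)) = act \<gamma> (coflag_of (b \<otimes> g))"
    "adj_flag poset 1 (act \<gamma> (coflag_of (b \<otimes> g))) = act \<gamma> (flag_of (b \<otimes> g))"
    by (rule adj; use g adjacent_flag_of[of g] adjacent_flag_of[of "b \<otimes> g"] in simp)+
  then show "act \<gamma> (flag_of (a \<otimes> g)) = adj_flag poset 0 (adj_flag poset 1 (act \<gamma> (flag_of g)))"
    "act \<gamma> (flag_of (b \<otimes> g)) = adj_flag poset 1 (adj_flag poset 2 (act \<gamma> (flag_of g)))"
    by simp_all
qed

text \<open>The image of one flag spreads by rotations to all \<open>flag_of g\<close>, and every
  element of the poset occurs in one of these.\<close>

lemma automorphism_of_flag:
  assumes \<gamma>: "\<gamma> \<in> automorphisms poset" and k: "k \<in> C" and base: "act \<gamma> (flag_of \<one>) = flag_of k"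
  shows "\<gamma> = rmul k"
proof -
  have fl: "act \<gamma> (flag_of g) = flag_of (g \<otimes> k)" if "g \<in> C" for g
    using that
    by (induction rule: carrier_induct) (use k base in \<open>auto simp: act_rotation[OF \<gamma>] adj_flag_of m_assoc\<close>)
  show ?thesis
  proof (rule extensionalityI[of _ "elements poset"])
    show "\<gamma> \<in> extensional (elements poset)"
      using \<gamma> by (auto simp: automorphisms_def Bij_def)
    show "rmul k \<in> extensional (elements poset)" by (simp add: rmul_def)
    show "\<gamma> x = rmul k x" if "x \<in> elements poset" for x
      using that fl k by (elim elements_cases) (auto simp: act_def flag_of_def)
  qed
qed

text \<open>An automorphism exchanging the two flag orbits sends \<open>flag_of g\<close> to
  \<open>coflag_of (\<eta> g)\<close>. As rotations act on the second orbit by inverse generators,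
  \<eta> turns left multiplication by \<open>a\<close> and \<open>b\<close> into that by their
  inverses.\<close>

lemma inverting_hom:
  assumes \<gamma>: "\<gamma> \<in> automorphisms poset" and k: "k \<in> C" and base: "act \<gamma> (flag_of \<one>) = coflag_of k"
  shows "\<exists>\<theta>\<in>hom G G. \<theta> a = inv a \<and> \<theta> b = inv b"
proof -
  have ex: "\<exists>h\<in>C. act \<gamma> (flag_of g) = coflag_of h" if "g \<in> C" for g
    using that
  proof (induction rule: carrier_induct)
    case one
    then show ?case using k base by blast
  next
    case (a g)
    then obtain h where "h \<in> C" "act \<gamma> (flag_of g) = coflag_of h" by blast
    then show ?case
      using a by (intro bexI[of _ "inv a \<otimes> h"]) (simp_all add: act_rotation[OF \<gamma>] adj_flag_of)
  next
    case (b g)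
    then obtain h where "h \<in> C" "act \<gamma> (flag_of g) = coflag_of h" by blast
    then show ?case
      using b by (intro bexI[of _ "inv b \<otimes> h"]) (simp_all add: act_rotation[OF \<gamma>] adj_flag_of)
  qed
  define \<eta> where "\<eta> g = (SOME h. h \<in> C \<and> act \<gamma> (flag_of g) = coflag_of h)" for g
  have \<eta>: "\<eta> g \<in> C" "act \<gamma> (flag_of g) = coflag_of (\<eta> g)" if "g \<in> C" for g
    using someI_ex[of "\<lambda>h. h \<in> C \<and> act \<gamma> (flag_of g) = coflag_of h"] ex[OF that]
    by (auto simp: \<eta>_def)
  have one: "\<eta> \<one> = k" using \<eta>[of \<one>] base k by simp
  have step: "\<eta> (a \<otimes> g) = inv a \<otimes> \<eta> g" "\<eta> (b \<otimes> g) = inv b \<otimes> \<eta> g" if g: "g \<in> C" for g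
  proof -
    have "coflag_of (\<eta> (a \<otimes> g)) = coflag_of (inv a \<otimes> \<eta> g)"
      using \<eta>(2)[of "a \<otimes> g"] \<eta>[OF g] g by (simp add: act_rotation[OF \<gamma>] adj_flag_of)
    then show "\<eta> (a \<otimes> g) = inv a \<otimes> \<eta> g" using \<eta>(1) g by simp
    have "coflag_of (\<eta> (b \<otimes> g)) = coflag_of (inv b \<otimes> \<eta> g)"
      using \<eta>(2)[of "b \<otimes> g"] \<eta>[OF g] g by (simp add: act_rotation[OF \<gamma>] adj_flag_of)
    then show "\<eta> (b \<otimes> g) = inv b \<otimes> \<eta> g" using \<eta>(1) g by simp
  qed
  \<comment> \<open>Since \<open>\<eta> \<one> = k\<close>, right multiplication by
    \<open>inv k\<close> makes the identity go to the identity.\<close>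
  define \<theta> where "\<theta> g = \<eta> g \<otimes> inv k" for g
  have \<theta>: "\<theta> g \<in> C" "\<theta> (a \<otimes> g) = inv a \<otimes> \<theta> g" "\<theta> (b \<otimes> g) = inv b \<otimes> \<theta> g" if "g \<in> C" for g
    using that \<eta>(1) k by (simp_all add: \<theta>_def step m_assoc)
  have \<theta>_one: "\<theta> \<one> = \<one>" using k by (simp add: \<theta>_def one)
  have "\<theta> (x \<otimes> y) = \<theta> x \<otimes> \<theta> y" if "x \<in> C" "y \<in> C" for x y
    using that(1)
    by (induction rule: carrier_induct) (use that(2) in \<open>simp_all add: \<theta> \<theta>_one m_assoc\<close>)
  then have "\<theta> \<in> hom G G" by (auto simp: hom_def \<theta>)
  moreover have "\<theta> a = inv a" "\<theta> b = inv b"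
    using \<theta>(2,3)[of \<one>] by (simp_all add: \<theta>_one)
  ultimately show ?thesis by blast
qed

section \<open>Chirality and the automorphism group\<close>

lemma automorphisms_poset:
  assumes chiral: "\<not> (\<exists>\<theta>\<in>hom G G. \<theta> a = inv a \<and> \<theta> b = inv b)"
  shows "automorphisms poset = rmul ` C"
proof (intro equalityI subsetI)
  fix \<gamma> assume \<gamma>: "\<gamma> \<in> automorphisms poset"
  then have "act \<gamma> (flag_of \<one>) \<in> flags poset"
    by (intro act_flag polyhedron_poset) simp_all
  \<comment> \<open>An image of the form \<open>coflag_of\<close> would give an inverting
    homomorphism.\<close>
  then obtain k where k: "k \<in> C" "act \<gamma> (flag_of \<one>) = flag_of k"
    using inverting_hom[OF \<gamma>] chiral by (auto simp: flags_poset)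
  then show "\<gamma> \<in> rmul ` C" using automorphism_of_flag[OF \<gamma>] by blast
qed (use rmul_automorphism in auto)

text \<open>Every adjacency exchanges the two families of flags, \<open>rmul\<close> is transitive
  on each, and an automorphism joining them would yield a homomorphism inverting both
  generators.\<close>

lemma chiral_polyhedron_poset:
  assumes chiral: "\<not> (\<exists>\<theta>\<in>hom G G. \<theta> a = inv a \<and> \<theta> b = inv b)"
  shows "chiral_polyhedron poset"
proof -
  have disj: "flag_of ` C \<inter> coflag_of ` C = {}" by auto
  have swap: "\<Phi> \<in> flag_of ` C \<longleftrightarrow> adj_flag poset i \<Phi> \<in> coflag_of ` C"
    if "\<Phi> \<in> flags poset" "i \<in> {0, 1, 2}" for \<Phi> i
  proof -
    from that(1) consider g where "g \<in> C" "\<Phi> = flag_of g" | g where "g \<in> C" "\<Phi> = coflag_of g"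
      by (auto simp: flags_poset)
    then show ?thesis
      using that(2) by cases (auto simp: adj_flag_of image_iff)
  qed
  have "\<exists>\<gamma>\<in>automorphisms poset. act \<gamma> (flag_of g) = flag_of h"
    "\<exists>\<gamma>\<in>automorphisms poset. act \<gamma> (coflag_of g) = coflag_of h" if "g \<in> C" "h \<in> C" for g h
    using that by (auto intro!: bexI[of _ "rmul (inv g \<otimes> h)"] rmul_automorphism)
  then have trans: "flag_transitive_on poset (flag_of ` C)" "flag_transitive_on poset (coflag_of ` C)"
    by (auto simp: flag_transitive_on_def)
  have "\<not> flag_transitive_on poset (flags poset)"
  proof
    assume "flag_transitive_on poset (flags poset)"
    then obtain \<gamma> where "\<gamma> \<in> automorphisms poset" "act \<gamma> (flag_of \<one>) = coflag_of \<one>"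
      using flag_of_mem[OF one_closed] unfolding flag_transitive_on_def by meson
    then show False using inverting_hom chiral by blast
  qed
  moreover have "\<exists>A B. A \<union> B = flags poset \<and> A \<inter> B = {} \<and>
      (\<forall>\<Phi>\<in>flags poset. \<forall>i\<in>{0, 1, 2}. \<Phi> \<in> A \<longleftrightarrow> adj_flag poset i \<Phi> \<in> B) \<and>
      flag_transitive_on poset A \<and> flag_transitive_on poset B"
    by (intro exI[of _ "flag_of ` C"] exI[of _ "coflag_of ` C"] conjI ballI)
      (fact flags_poset[symmetric] disj swap trans)+
  ultimately show ?thesis
    using polyhedron_poset unfolding chiral_polyhedron_def by blast
qed

text \<open>Products in \<open>Aut\<close> are taken from left to right, so right multiplication is
  a homomorphism. It is injective because the group element can be read off the image of the base
  flag.\<close>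

lemma iso_Aut_poset:
  assumes chiral: "\<not> (\<exists>\<theta>\<in>hom G G. \<theta> a = inv a \<and> \<theta> b = inv b)"
  shows "rmul \<in> iso G (Aut poset)"
proof (rule isoI)
  show "rmul \<in> hom G (Aut poset)"
  proof (rule homI)
    fix k l assume kl: "k \<in> C" "l \<in> C"
    have "rmul (k \<otimes> l) x = compose (elements poset) (rmul l) (rmul k) x" for x
    proof (cases "x \<in> elements poset")
      case True
      then show ?thesis using kl by (simp add: compose_eq rmul_rmul)
    next
      case False
      then show ?thesis by (simp add: rmul_def compose_def)
    qed
    then have "rmul (k \<otimes> l) = compose (elements poset) (rmul l) (rmul k)" by (rule ext)
    then show "rmul (k \<otimes> l) = rmul k \<otimes>\<^bsub>Aut poset\<^esub> rmul l" by (simp add: Aut_def)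
  qed (simp add: Aut_def rmul_automorphism)
  have "inj_on rmul C"
  proof (rule inj_onI)
    fix k l assume kl: "k \<in> C" "l \<in> C" "rmul k = rmul l"
    have "flag_of k = act (rmul k) (flag_of \<one>)" using kl(1) by simp
    also have "\<dots> = flag_of l" unfolding kl(3) using kl(2) by simp
    finally show "k = l" using kl(1,2) by simp
  qed
  then show "bij_betw rmul (carrier G) (carrier (Aut poset))"
    by (simp add: bij_betw_def Aut_def automorphisms_poset[OF chiral])
qed

lemma distinguished_generators_poset:
  "distinguished_generators poset (flag_of \<one>) (rmul a) (rmul b)"
  unfolding distinguished_generators_def using rmul_automorphism by (simp add: adj_flag_of)

end

section \<open>Factorisation from the relations\<close>

context group begin

lemma int_pow_conj:
  assumes "x \<in> carrier G" "y \<in> carrier G" "z \<in> carrier G" and eq: "y \<otimes> x = x \<otimes> z"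
  shows "y [^] (k :: int) \<otimes> x = x \<otimes> z [^] k"
proof -
  have nat: "y [^] n \<otimes> x = x \<otimes> z [^] n" for n :: nat
  proof (induction n)
    case (Suc n)
    have "y [^] Suc n \<otimes> x = y [^] n \<otimes> (y \<otimes> x)" using assms by (simp add: m_assoc)
    also have "\<dots> = y [^] n \<otimes> x \<otimes> z" using assms by (simp add: eq m_assoc)
    also have "\<dots> = x \<otimes> z [^] Suc n" using assms by (simp add: Suc m_assoc)
    finally show ?case .
  qed (use assms in simp)
  show ?thesis
  proof (cases k rule: int_cases2)
    case (nonneg n)
    then show ?thesis using nat by (simp add: int_pow_int)
  next
    case (nonpos n)
    have "inv (y [^] n) \<otimes> x = inv (y [^] n) \<otimes> (x \<otimes> z [^] n) \<otimes> inv (z [^] n)"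
      using assms by (simp add: m_assoc)
    also have "\<dots> = x \<otimes> inv (z [^] n)"
      using assms by (simp add: nat[symmetric] m_assoc[symmetric])
    finally show ?thesis using assms nonpos by (simp add: int_pow_neg_int)
  qed
qed

lemma int_pow_eq_nat_pow:
  assumes "x \<in> carrier G" "x [^] (N :: nat) = \<one>" "N > 0"
  shows "x [^] (k :: int) = x [^] nat (k mod int N)"
proof -
  have "int (ord x) dvd int N" using assms pow_eq_id by simp
  also have "int N dvd nat (k mod int N) - k"
    using assms(3) by (simp add: mod_eq_dvd_iff[symmetric])
  finally have "x [^] k = x [^] int (nat (k mod int N))"
    using assms(1) by (subst int_pow_eq)
  then show ?thesis by (simp add: int_pow_int)
qed

text \<open>The last relation yields b^-1 a^-2 = a^-2 b^c, so powers of b move past a^-2. As ba = a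
  (a^-2 b^-1), the product b^j a is \<open>a\<close> times a power of a^-2 b^-1, and such powers
  collapse to the form a^k b^l.\<close>

lemma product_closed_right_mult:
  assumes a: "a \<in> carrier G" and b: "b \<in> carrier G"
    and bN: "b [^] (N :: nat) = \<one>" "N > 0" and abab: "a \<otimes> b \<otimes> (a \<otimes> b) = \<one>"
    and rel: "b \<otimes> inv a = a [^] (-3 :: int) \<otimes> b [^] (c :: int)"
  shows "\<exists>(k :: int) (l :: int). a [^] (i :: int) \<otimes> b [^] (j :: int) \<otimes> a = a [^] k \<otimes> b [^] l"
proof -
  let ?x = "a [^] (-2 :: int)"
  let ?y = "?x \<otimes> inv b"
  have ab: "a \<otimes> b = inv b \<otimes> inv a"
    using abab a b by (metis inv_equality inv_mult_group m_closed inv_inv)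
  have ba: "b \<otimes> a = inv a \<otimes> inv b"
    using abab a b by (metis inv_equality inv_mult_group m_closed inv_inv m_assoc inv_solve_left r_one inv_closed)
  have pow_a: "a [^] k \<otimes> a [^] l = a [^] (k + l)" for k l :: int
    using a by (simp add: int_pow_mult)
  have inv_a: "inv a = a [^] (-1 :: int)" and a1: "a = a [^] (1 :: int)"
    using a by (simp_all add: int_pow_neg)
  \<comment> \<open>Here b^-1 a^-1 = ab, after which the hypothesis \<open>rel\<close> rewrites b
    a^-1.\<close>
  have "inv b \<otimes> ?x = inv b \<otimes> inv a \<otimes> inv a"
    using a b pow_a[of "-1" "-1"] by (simp add: m_assoc inv_a)
  also have "\<dots> = a \<otimes> (b \<otimes> inv a)" using a b by (simp add: ab[symmetric] m_assoc)
  also have "\<dots> = a [^] (1 :: int) \<otimes> a [^] (-3 :: int) \<otimes> b [^] c"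
    using a b by (simp add: rel m_assoc)
  also have "\<dots> = ?x \<otimes> b [^] c" using pow_a[of 1 "-3"] by simp
  finally have "inv b [^] (- n) \<otimes> ?x = ?x \<otimes> (b [^] c) [^] (- n)" for n :: int
    using a b by (intro int_pow_conj) simp_all
  then have shift: "b [^] n \<otimes> ?x = ?x \<otimes> b [^] (- (c * n))" for n :: int
    using b by (simp add: int_pow_inv int_pow_neg int_pow_pow)
  have "\<exists>(k :: int) (l :: int). ?y [^] n = a [^] k \<otimes> b [^] l" for n :: nat
  proof (induction n)
    case 0
    show ?case by (intro exI[of _ 0]) simp
  next
    case (Suc n)
    then obtain k l :: int where "?y [^] n = a [^] k \<otimes> b [^] l" by blast
    then have "?y [^] Suc n = a [^] k \<otimes> (b [^] l \<otimes> ?x) \<otimes> inv b"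
      using a b by (simp add: m_assoc)
    also have "\<dots> = a [^] k \<otimes> ?x \<otimes> (b [^] (- (c * l)) \<otimes> b [^] (-1 :: int))"
      using a b by (simp add: shift m_assoc int_pow_neg[of b 1])
    also have "\<dots> = a [^] (k + -2) \<otimes> b [^] (- (c * l) + -1)"
      using a b by (simp only: int_pow_mult)
    finally show ?case by blast
  qed
  \<comment> \<open>Reduction modulo \<open>N\<close> makes the exponent \<open>j\<close> a natural
    number, to which the induction applies.\<close>
  then obtain k l :: int where kl: "?y [^] nat (j mod int N) = a [^] k \<otimes> b [^] l" by blast
  have "b \<otimes> a = a \<otimes> ?y"
    using a b pow_a[of 1 "-2"] by (simp add: ba m_assoc[symmetric] inv_a)
  then have "b [^] int (nat (j mod int N)) \<otimes> a = a \<otimes> ?y [^] int (nat (j mod int N))"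
    using a b by (intro int_pow_conj) simp_all
  then have "b [^] j \<otimes> a = a \<otimes> (a [^] k \<otimes> b [^] l)"
    unfolding int_pow_int kl using int_pow_eq_nat_pow[OF b bN] by simp
  then have "a [^] i \<otimes> b [^] j \<otimes> a = a [^] i \<otimes> a [^] (1 :: int) \<otimes> a [^] k \<otimes> b [^] l"
    using a b by (simp add: m_assoc)
  also have "\<dots> = a [^] (i + 1 + k) \<otimes> b [^] l" by (simp only: pow_a)
  finally show ?thesis by blast
qed

end

section \<open>Powers of generators in a presented group\<close>

lemma one_presented_group: "\<one>\<^bsub>presented_group R\<^esub> = word_class R []"
  by (simp add: presented_group_def)

lemma word_class_mem [simp]: "word_class R w \<in> carrier (presented_group R)"
  by (simp add: presented_group_def)

lemma generator_mem [simp]: "generator R x \<in> carrier (presented_group R)"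
  by (simp add: generator_def)

lemma word_class_letter:
  "word_class R [(x, True)] = generator R x"
  "word_class R [(x, False)] = inv\<^bsub>presented_group R\<^esub> generator R x"
proof -
  interpret group "presented_group R" by (rule group_presented_group)
  show eq: "word_class R [(x, True)] = generator R x"
    by (simp add: generator_def gpow_def)
  have "word_class R [(x, False)] \<otimes>\<^bsub>presented_group R\<^esub> word_class R [(x, True)] = \<one>\<^bsub>presented_group R\<^esub>"
    using pres_eq.cancel[of R "[]" x False "[]"]
    by (simp add: mult_word_class one_presented_group word_class_eq_iff)
  then show "word_class R [(x, False)] = inv\<^bsub>presented_group R\<^esub> generator R x"
    unfolding eq by (intro inv_equality[symmetric]) simp_all
qed

lemma word_class_gpow: "word_class R (gpow x k) = generator R x [^]\<^bsub>presented_group R\<^esub> k"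
proof -
  interpret group "presented_group R" by (rule group_presented_group)
  have rep: "word_class R (replicate n l) = word_class R [l] [^]\<^bsub>presented_group R\<^esub> n" for l n
  proof (induction n)
    case (Suc n)
    have "word_class R (replicate (Suc n) l) = word_class R (replicate n l @ [l])"
      by (simp add: replicate_append_same)
    then show ?case by (simp only: mult_word_class[symmetric] Suc nat_pow_Suc)
  qed (simp add: one_presented_group)
  show ?thesis
  proof (cases k rule: int_cases2)
    case (nonneg n)
    then show ?thesis by (simp add: gpow_def rep word_class_letter int_pow_int)
  next
    case (nonpos n)
    \<comment> \<open>For \<open>n = 0\<close> the exponent counts as nonnegative in
      \<open>gpow\<close>, so only nonzero \<open>n\<close> give inverse letters.\<close>
    show ?thesis
    proof (cases "n = 0")
      case True
      then show ?thesis using nonpos by (simp add: gpow_def one_presented_group)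
    next
      case False
      then show ?thesis
        using nonpos by (simp add: gpow_def rep word_class_letter int_pow_neg_int nat_pow_inv)
    qed
  qed
qed

lemma word_class_relation: "(l, r) \<in> R \<Longrightarrow> word_class R l = word_class R r"
  using pres_eq.relation[of l r R "[]" "[]"] by (simp add: word_class_eq_iff)

section \<open>A coordinate action\<close>

text \<open>The pair \<open>(i, j)\<close>, read modulo \<open>8\<close> and \<open>32 u\<close>, stands for \<open>\<sigma>\<^sub>1\<^sup>i \<sigma>\<^sub>2\<^sup>j\<close>, and letters act
  by multiplication on the right. The quadratic term comes from
  \<open>\<sigma>\<^sub>2\<^sup>j \<sigma>\<^sub>1 = \<sigma>\<^sub>1 (\<sigma>\<^sub>1\<^sup>-\<^sup>2 \<sigma>\<^sub>2\<^sup>-\<^sup>1)\<^sup>j\<close>, since \<open>\<sigma>\<^sub>1\<^sup>2\<close> conjugates \<open>\<sigma>\<^sub>2\<close> to a power of itself.\<close>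

fun step :: "int \<Rightarrow> gen \<times> bool \<Rightarrow> int \<times> int \<Rightarrow> int \<times> int" where
  "step u (Sigma1, True) (i, j) = (i + 1 - 2 * j, - j - 4 * u * (j * (j - 1)))"
| "step u (Sigma1, False) (i, j) = (i - 1 - 2 * j, - j - 4 * u * (j * (j + 1)))"
| "step u (Sigma2, True) (i, j) = (i, j + 1)"
| "step u (Sigma2, False) (i, j) = (i, j - 1)"

text \<open>Congruence on integer pairs stands in for the quotient, so that claims about the action
  become polynomial identities with explicit multipliers. Divisibility ignores the sign of
  \<open>u\<close>.\<close>

definition coord_eq :: "int \<Rightarrow> int \<times> int \<Rightarrow> int \<times> int \<Rightarrow> bool" where
  "coord_eq u s t \<longleftrightarrow> 8 dvd fst s - fst t \<and> 32 * u dvd snd s - snd t"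

lemma coord_eqI: "i = k + 8 * m \<Longrightarrow> j = l + 32 * u * n \<Longrightarrow> coord_eq u (i, j) (k, l)"
  by (simp add: coord_eq_def)

lemma coord_eqE:
  assumes "coord_eq u (i, j) (k, l)"
  obtains m n where "i = k + 8 * m" "j = l + 32 * u * n"
proof -
  obtain m n where "i - k = 8 * m" "j - l = 32 * u * n"
    using assms unfolding coord_eq_def dvd_def fst_conv snd_conv by blast
  then show ?thesis using that[of m n] by simp
qed

lemma coord_eq_refl: "coord_eq u s s"
  by (simp add: coord_eq_def)

lemma coord_eq_sym: "coord_eq u s t \<Longrightarrow> coord_eq u t s"
  by (simp add: coord_eq_def dvd_diff_commute)

lemma coord_eq_trans [trans]: "coord_eq u r s \<Longrightarrow> coord_eq u s t \<Longrightarrow> coord_eq u r t"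
  using dvd_add[of 8 "fst r - fst s" "fst s - fst t"] dvd_add[of "32 * u" "snd r - snd s" "snd s - snd t"]
  by (simp add: coord_eq_def)

lemma step_cong:
  assumes "coord_eq u s t"
  shows "coord_eq u (step u x s) (step u x t)"
proof -
  obtain i j k l where st: "s = (i, j)" "t = (k, l)" by (cases s, cases t)
  obtain m n where mn: "i = k + 8 * m" "j = l + 32 * u * n"
    using assms unfolding st by (rule coord_eqE)
  have "coord_eq u (step u (Sigma1, True) s) (step u (Sigma1, True) t)"
    unfolding st step.simps mn
    \<comment> \<open>The multipliers collect what the shift of j by 32un contributes: 64un to 2j,
      and a multiple of 32un to j(j - 1).\<close>
    by (rule coord_eqI[of _ _ "m - 8 * u * n" _ _ _ "- n - 4 * u * n * (2 * l + 32 * u * n - 1)"])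
      (simp_all add: algebra_simps)
  moreover have "coord_eq u (step u (Sigma1, False) s) (step u (Sigma1, False) t)"
    unfolding st step.simps mn
    by (rule coord_eqI[of _ _ "m - 8 * u * n" _ _ _ "- n - 4 * u * n * (2 * l + 32 * u * n + 1)"])
      (simp_all add: algebra_simps)
  moreover have "coord_eq u (step u (Sigma2, True) s) (step u (Sigma2, True) t)"
    "coord_eq u (step u (Sigma2, False) s) (step u (Sigma2, False) t)"
    unfolding st step.simps mn by (rule coord_eqI[of _ _ m _ _ _ n]; simp)+
  moreover obtain y c where "x = (y, c)" by (cases x)
  ultimately show ?thesis
    by (cases y; cases c) simp_all
qed

text \<open>Products of consecutive integers are even, which supplies the factor two that makes
  terms in 16u^2 multiples of 32u. The equations for \<open>u * (j * j)\<close> let simplification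
  eliminate squares.\<close>

lemma obtain_triangular:
  fixes j u :: int
  obtains T S where "j * (j - 1) = 2 * T" "u * (j * j) = u * j + 2 * (u * T)"
    "j * (j + 1) = 2 * S" "u * (j * j) = 2 * (u * S) - u * j"
proof -
  have "even (j * j - j)" by simp
  then obtain T where "j * j - j = 2 * T" by (elim evenE)
  then have "j * j = j + 2 * T" by simp
  then show ?thesis using that[of T "T + j"] by (simp add: algebra_simps)
qed

lemma step_cancel: "coord_eq u (step u (x, \<not> b) (step u (x, b) s)) s"
proof -
  obtain i j where s: "s = (i, j)" by (cases s)
  obtain T S where T: "j * (j - 1) = 2 * T" "u * (j * j) = u * j + 2 * (u * T)"
    and S: "j * (j + 1) = 2 * S" "u * (j * j) = 2 * (u * S) - u * j"
    by (rule obtain_triangular)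
  have "coord_eq u (step u (Sigma1, False) (step u (Sigma1, True) s)) s"
    unfolding s step.simps T(1)
    \<comment> \<open>With j(j - 1) = 2T the terms 8uT cancel in the second coordinate, leaving j
      plus 32u times this multiplier.\<close>
    by (rule coord_eqI[of _ _ "2 * u * T" _ _ _ "- u * (2 * j * T + 8 * u * T * T - T)"])
      (use T(2) in \<open>simp_all add: algebra_simps\<close>)
  moreover have "coord_eq u (step u (Sigma1, True) (step u (Sigma1, False) s)) s"
    unfolding s step.simps S(1)
    by (rule coord_eqI[of _ _ "2 * u * S" _ _ _
          "- u * (2 * j * S + 8 * u * S * S + S)"])
      (use S(2) in \<open>simp_all add: algebra_simps\<close>)
  moreover have "coord_eq u (step u (Sigma2, False) (step u (Sigma2, True) s)) s"
    "coord_eq u (step u (Sigma2, True) (step u (Sigma2, False) s)) s"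
    by (simp_all add: s coord_eq_refl)
  ultimately show ?thesis
    by (cases x; cases b) simp_all
qed

lemma fold_step_cong: "coord_eq u s t \<Longrightarrow> coord_eq u (fold (step u) w s) (fold (step u) w t)"
  by (induction w arbitrary: s t) (simp_all add: step_cong)

section \<open>Powers of the generators in the action\<close>

lemma fold_step_gpow2: "fold (step u) (gpow Sigma2 k) (i, j) = (i, j + k)"
proof -
  have "fold (step u) (replicate n (Sigma2, True)) (i, j) = (i, j + int n)"
    "fold (step u) (replicate n (Sigma2, False)) (i, j) = (i, j - int n)" for n
    by (induction n arbitrary: j) simp_all
  then show ?thesis by (cases "k \<ge> 0") (simp_all add: gpow_def)
qed

text \<open>In second coordinate zero the quadratic term vanishes.\<close>

lemma fold_step_gpow1: "fold (step u) (gpow Sigma1 k) (i, 0) = (i + k, 0)"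
proof -
  have "fold (step u) (replicate n (Sigma1, True)) (i, 0) = (i + int n, 0)"
    "fold (step u) (replicate n (Sigma1, False)) (i, 0) = (i - int n, 0)" for n
    by (induction n arbitrary: i) simp_all
  then show ?thesis by (cases "k \<ge> 0") (simp_all add: gpow_def)
qed

text \<open>The quadratic terms of two steps cancel modulo 32u, which reflects a^-2 b a^2 = b^(1 -
  8u). The factor 1 + 8u of the inverse letters inverts 1 - 8u, as 64u^2 is a multiple of
  32u.\<close>

lemma step_square:
  "coord_eq u (step u (Sigma1, True) (step u (Sigma1, True) (i, j))) (i + 2, j - 8 * u * j)"
  "coord_eq u (step u (Sigma1, False) (step u (Sigma1, False) (i, j))) (i - 2, j + 8 * u * j)"
proof -
  obtain T S where T: "j * (j - 1) = 2 * T" "u * (j * j) = u * j + 2 * (u * T)"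
    and S: "j * (j + 1) = 2 * S" "u * (j * j) = 2 * (u * S) - u * j"
    by (rule obtain_triangular)
  show "coord_eq u (step u (Sigma1, True) (step u (Sigma1, True) (i, j))) (i + 2, j - 8 * u * j)"
    unfolding step.simps T(1)
    by (rule coord_eqI[of _ _ "2 * u * T" _ _ _ "- u * (2 * j * T + 8 * u * T * T + T)"])
      (use T(2) in \<open>simp_all add: algebra_simps\<close>)
  show "coord_eq u (step u (Sigma1, False) (step u (Sigma1, False) (i, j))) (i - 2, j + 8 * u * j)"
    unfolding step.simps S(1)
    by (rule coord_eqI[of _ _ "2 * u * S" _ _ _
          "- u * (2 * j * S + 8 * u * S * S - S)"])
      (use S(2) in \<open>simp_all add: algebra_simps\<close>)
qed

text \<open>A square followed by one more letter; these forms evaluate the right-hand sides of the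
  last two relations.\<close>

lemma step_cube:
  "coord_eq u (fold (step u) (gpow Sigma1 3) (i, j)) (i + 3 - 2 * j, - j + 8 * u * j - 4 * u * (j * (j - 1)))"
  "coord_eq u (fold (step u) (gpow Sigma1 (-3)) (i, j)) (i - 3 - 2 * j, - j - 8 * u * j - 4 * u * (j * (j + 1)))"
proof -
  let ?a = "step u (Sigma1, True)" and ?a' = "step u (Sigma1, False)"
  have "fold (step u) (gpow Sigma1 3) (i, j) = ?a (?a (?a (i, j)))"
    by (simp add: gpow_def numeral_3_eq_3)
  also have "coord_eq u \<dots> (?a (i + 2, j - 8 * u * j))"
    by (rule step_cong[OF step_square(1)])
  also have "coord_eq u \<dots> (i + 3 - 2 * j, - j + 8 * u * j - 4 * u * (j * (j - 1)))"
    unfolding step.simps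
    by (rule coord_eqI[of _ _ "2 * u * j" _ _ _ "- u * (8 * u * j * j - 2 * j * j + j)"])
      (simp_all add: algebra_simps)
  finally show "coord_eq u (fold (step u) (gpow Sigma1 3) (i, j))
    (i + 3 - 2 * j, - j + 8 * u * j - 4 * u * (j * (j - 1)))" .
  have "fold (step u) (gpow Sigma1 (-3)) (i, j) = ?a' (?a' (?a' (i, j)))"
    by (simp add: gpow_def numeral_3_eq_3)
  also have "coord_eq u \<dots> (?a' (i - 2, j + 8 * u * j))"
    by (rule step_cong[OF step_square(2)])
  also have "coord_eq u \<dots> (i - 3 - 2 * j, - j - 8 * u * j - 4 * u * (j * (j + 1)))"
    unfolding step.simps
    by (rule coord_eqI[of _ _ "- 2 * u * j" _ _ _ "- u * (8 * u * j * j + 2 * j * j + j)"])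
      (simp_all add: algebra_simps)
  finally show "coord_eq u (fold (step u) (gpow Sigma1 (-3)) (i, j))
    (i - 3 - 2 * j, - j - 8 * u * j - 4 * u * (j * (j + 1)))" .
qed

text \<open>On the second coordinate a^4 acts as 1 - 16u, which is (1 - 8u)^2 modulo 32u, and (1 -
  16u)^2 is congruent to 1.\<close>

lemma step_eighth: "coord_eq u (fold (step u) (gpow Sigma1 8) s) s"
proof -
  let ?a = "step u (Sigma1, True)"
  have four: "coord_eq u (?a (?a (?a (?a (i, j))))) (i + 4, j - 16 * u * j)" for i j
  proof -
    have "coord_eq u (?a (?a (?a (?a (i, j))))) (?a (?a (i + 2, j - 8 * u * j)))"
      by (intro step_cong step_square(1))
    also have "coord_eq u \<dots> (i + 2 + 2, j - 8 * u * j - 8 * u * (j - 8 * u * j))"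
      by (rule step_square(1))
    also have "coord_eq u \<dots> (i + 4, j - 16 * u * j)"
      by (rule coord_eqI[of _ _ 0 _ _ _ "2 * u * j"]) (simp_all add: algebra_simps)
    finally show ?thesis .
  qed
  obtain i j where s: "s = (i, j)" by (cases s)
  have "gpow Sigma1 8 = replicate 8 (Sigma1, True)" by (simp add: gpow_def)
  also have "\<dots> = (Sigma1, True) # (Sigma1, True) # (Sigma1, True) # (Sigma1, True) #
    (Sigma1, True) # (Sigma1, True) # (Sigma1, True) # (Sigma1, True) # []"
    by (simp add: numeral_eq_Suc)
  finally have "fold (step u) (gpow Sigma1 8) s = ?a (?a (?a (?a (?a (?a (?a (?a (i, j))))))))"
    by (simp add: s)
  also have "coord_eq u \<dots> (?a (?a (?a (?a (i + 4, j - 16 * u * j)))))"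
    by (intro step_cong four)
  also have "coord_eq u \<dots> (i + 4 + 4, j - 16 * u * j - 16 * u * (j - 16 * u * j))"
    by (rule four)
  also have "coord_eq u \<dots> s"
    unfolding s by (rule coord_eqI[of _ _ 1 _ _ _ "- j + 8 * u * j"]) (simp_all add: algebra_simps)
  finally show ?thesis .
qed

text \<open>Replacing j by 1 - j preserves j(j - 1), so the quadratic corrections of the two rounds
  cancel modulo 32u.\<close>

lemma step_involution:
  "coord_eq u (fold (step u) [(Sigma1, True), (Sigma2, True), (Sigma1, True), (Sigma2, True)] s) s"
proof -
  obtain i j where s: "s = (i, j)" by (cases s)
  obtain T S where T: "j * (j - 1) = 2 * T" "u * (j * j) = u * j + 2 * (u * T)"
    and S: "j * (j + 1) = 2 * S" "u * (j * j) = 2 * (u * S) - u * j"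
    by (rule obtain_triangular)
  have "coord_eq u (step u (Sigma2, True) (step u (Sigma1, True)
      (step u (Sigma2, True) (step u (Sigma1, True) (i, j))))) (i, j)"
    unfolding step.simps T(1)
    by (rule coord_eqI[of _ _ "2 * u * T" _ _ _ "- u * (T * (2 * j - 1) + 8 * u * T * T)"])
      (use T(2) in \<open>simp_all add: algebra_simps\<close>)
  then show ?thesis by (simp add: s)
qed

text \<open>One family covers both groups of the theorem: u = 2^n gives the first and u = -2^n the
  second, whence the absolute value in the exponent of the second generator.\<close>

abbreviation rels :: "int \<Rightarrow> (gen word \<times> gen word) set" where
  "rels u \<equiv> Gamma_rels 8 (32 * \<bar>u\<bar>) 3 (1 - 8 * u) (-3) (-1 - 8 * u)"

lemma step_relation:
  assumes "(l, r) \<in> rels u"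
  shows "coord_eq u (fold (step u) l s) (fold (step u) r s)"
proof -
  obtain i j where s: "s = (i, j)" by (cases s)
  consider "l = gpow Sigma1 8" "r = []" | "l = gpow Sigma2 (32 * \<bar>u\<bar>)" "r = []"
    | "l = [(Sigma1, True), (Sigma2, True), (Sigma1, True), (Sigma2, True)]" "r = []"
    | "l = [(Sigma2, False), (Sigma1, True)]" "r = gpow Sigma1 3 @ gpow Sigma2 (1 - 8 * u)"
    | "l = [(Sigma2, True), (Sigma1, False)]" "r = gpow Sigma1 (-3) @ gpow Sigma2 (-1 - 8 * u)"
    using assms by (auto simp: Gamma_rels_def gpow_def[of _ 1] gpow_def[of _ "-1"])
  then show ?thesis
  proof cases
    case 1
    then show ?thesis by (simp add: step_eighth)
  next
    case 2
    have "coord_eq u (i, j + 32 * \<bar>u\<bar>) (i, j)"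
      \<comment> \<open>The multiplier \<open>sgn u\<close> turns 32u into 32|u|.\<close>
      by (rule coord_eqI[of _ _ 0 _ _ _ "sgn u"]) (simp_all add: abs_sgn mult.assoc)
    then show ?thesis using 2 by (simp add: s fold_step_gpow2)
  next
    case 3
    then show ?thesis using step_involution by simp
  next
    case 4
    have "coord_eq u (fold (step u) r s) (fold (step u) (gpow Sigma2 (1 - 8 * u))
        (i + 3 - 2 * j, - j + 8 * u * j - 4 * u * (j * (j - 1))))"
      unfolding 4 s fold_append comp_apply by (rule fold_step_cong[OF step_cube(1)])
    \<comment> \<open>The cube followed by the shift agrees with the left-hand word as a polynomial,
      without further reduction.\<close>
    also have "\<dots> = fold (step u) l s"
      by (simp add: 4 s fold_step_gpow2 algebra_simps)
    finally show ?thesis by (rule coord_eq_sym)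
  next
    case 5
    have "coord_eq u (fold (step u) r s) (fold (step u) (gpow Sigma2 (-1 - 8 * u))
        (i - 3 - 2 * j, - j - 8 * u * j - 4 * u * (j * (j + 1))))"
      unfolding 5 s fold_append comp_apply by (rule fold_step_cong[OF step_cube(2)])
    also have "\<dots> = fold (step u) l s"
      by (simp add: 5 s fold_step_gpow2 algebra_simps)
    finally show ?thesis by (rule coord_eq_sym)
  qed
qed

text \<open>Words equal in the group act alike up to congruence, so incongruent states separate
  group elements.\<close>

lemma fold_step_pres_eq:
  assumes "pres_eq (rels u) w w'"
  shows "coord_eq u (fold (step u) w s) (fold (step u) w' s)"
  using assms
proof (induction arbitrary: s)
  case (refl w)
  show ?case by (rule coord_eq_refl)
next
  case (sym w w')
  show ?case by (rule coord_eq_sym) (rule sym.IH)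
next
  case (trans w w' w'')
  show ?case by (rule coord_eq_trans) (rule trans.IH)+
next
  case (cancel w x b w')
  show ?case using step_cancel by (simp add: fold_step_cong)
next
  case (relation l r w w')
  then show ?case by (simp add: fold_step_cong step_relation)
qed

section \<open>The groups of the theorem\<close>

context
  fixes u :: int and G (structure) and a b
  assumes u: "u \<noteq> 0"
  defines "G \<equiv> presented_group (rels u)"
  defines "a \<equiv> generator (rels u) Sigma1"
  defines "b \<equiv> generator (rels u) Sigma2"
begin

interpretation group G
  unfolding G_def by (rule group_presented_group)

lemma a_mem [simp]: "a \<in> carrier G" and b_mem [simp]: "b \<in> carrier G"
  by (simp_all add: G_def a_def b_def)

lemma class_gpow [simp]:
  "word_class (rels u) (gpow Sigma1 k) = a [^] k" "word_class (rels u) (gpow Sigma2 k) = b [^] k"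
  by (simp_all add: word_class_gpow G_def a_def b_def)

lemma class_append: "word_class (rels u) (w @ w') = word_class (rels u) w \<otimes> word_class (rels u) w'"
  by (simp add: G_def mult_word_class)

lemma class_Nil: "word_class (rels u) [] = \<one>"
  by (simp add: G_def one_presented_group)

text \<open>From (0, 0) the word for a^i b^j leads to (i, j), and a trivial product must return to
  the origin up to congruence. This yields both the orders of the generators and the trivial
  intersection.\<close>

lemma power_product_eq_one:
  assumes "a [^] (i :: int) \<otimes> b [^] (j :: int) = \<one>"
  shows "8 dvd i" "32 * u dvd j"
proof -
  have "pres_eq (rels u) (gpow Sigma1 i @ gpow Sigma2 j) []"
    using assms by (simp add: word_class_eq_iff[symmetric] class_append class_Nil)
  from fold_step_pres_eq[OF this, of "(0, 0)"] show "8 dvd i" "32 * u dvd j"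
    by (simp_all add: fold_step_gpow1 fold_step_gpow2 coord_eq_def)
qed

lemma group_relations:
  "a [^] (8 :: int) = \<one>" "b [^] (32 * \<bar>u\<bar>) = \<one>" "a \<otimes> b \<otimes> (a \<otimes> b) = \<one>"
  "inv b \<otimes> a = a [^] (3 :: int) \<otimes> b [^] (1 - 8 * u)"
  "b \<otimes> inv a = a [^] (-3 :: int) \<otimes> b [^] (-1 - 8 * u)"
proof -
  have "(gpow Sigma1 8, []) \<in> rels u" "(gpow Sigma2 (32 * \<bar>u\<bar>), []) \<in> rels u"
    "(gpow Sigma1 1 @ gpow Sigma2 1 @ gpow Sigma1 1 @ gpow Sigma2 1, []) \<in> rels u"
    "(gpow Sigma2 (-1) @ gpow Sigma1 1, gpow Sigma1 3 @ gpow Sigma2 (1 - 8 * u)) \<in> rels u"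
    "(gpow Sigma2 1 @ gpow Sigma1 (-1), gpow Sigma1 (-3) @ gpow Sigma2 (-1 - 8 * u)) \<in> rels u"
    by (simp_all add: Gamma_rels_def)
  note rel = this[THEN word_class_relation]
  have inv: "b [^] (-1 :: int) = inv b" "a [^] (-1 :: int) = inv a"
    by (simp_all add: int_pow_neg)
  show "a [^] (8 :: int) = \<one>" using rel(1) by (simp add: class_Nil)
  show "b [^] (32 * \<bar>u\<bar>) = \<one>" using rel(2) by (simp add: class_Nil)
  show "a \<otimes> b \<otimes> (a \<otimes> b) = \<one>" using rel(3) by (simp add: class_Nil class_append m_assoc)
  show "inv b \<otimes> a = a [^] (3 :: int) \<otimes> b [^] (1 - 8 * u)"
    using rel(4) by (simp add: class_append inv)
  show "b \<otimes> inv a = a [^] (-3 :: int) \<otimes> b [^] (-1 - 8 * u)"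
    using rel(5) by (simp add: class_append inv)
qed

section \<open>Orders of the generators and normal forms\<close>

lemma pow_eq_one_iff:
  "a [^] (i :: int) = \<one> \<longleftrightarrow> 8 dvd i" "b [^] (j :: int) = \<one> \<longleftrightarrow> 32 * u dvd j"
proof -
  have mult: "a [^] (8 * m) = \<one>" "b [^] (32 * \<bar>u\<bar> * m) = \<one>" for m :: int
    by (simp_all add: int_pow_pow[symmetric] group_relations)
  show "a [^] i = \<one> \<longleftrightarrow> 8 dvd i"
    using power_product_eq_one(1)[of i 0] mult(1) by (auto elim: dvdE)
  have "b [^] j = \<one>" if "32 * u dvd j"
  proof -
    have "32 * \<bar>u\<bar> dvd j" using that by (simp add: abs_if)
    then show ?thesis using mult(2) by (auto elim: dvdE)
  qed
  then show "b [^] j = \<one> \<longleftrightarrow> 32 * u dvd j"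
    using power_product_eq_one(2)[of 0 j] by auto
qed

lemma ord_generators: "ord a = 8" "ord b = 32 * nat \<bar>u\<bar>"
proof -
  have "a [^] n = \<one> \<longleftrightarrow> 8 dvd n" "b [^] n = \<one> \<longleftrightarrow> 32 * nat \<bar>u\<bar> dvd n" for n :: nat
  proof -
    show "a [^] n = \<one> \<longleftrightarrow> 8 dvd n"
      using pow_eq_one_iff(1)[of "int n"] by (simp add: int_pow_int) presburger
    have "32 * u dvd int n \<longleftrightarrow> int (32 * nat \<bar>u\<bar>) dvd int n" by (simp add: abs_if)
    also have "\<dots> \<longleftrightarrow> 32 * nat \<bar>u\<bar> dvd n" by (rule int_dvd_int_iff)
    finally show "b [^] n = \<one> \<longleftrightarrow> 32 * nat \<bar>u\<bar> dvd n"
      using pow_eq_one_iff(2)[of "int n"] by (simp add: int_pow_int)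
  qed
  then show "ord a = 8" "ord b = 32 * nat \<bar>u\<bar>"
    by (simp_all add: ord_unique)
qed

lemma nat_pow_generators: "a [^] (8 :: nat) = \<one>" "b [^] (32 * nat \<bar>u\<bar>) = \<one>"
  using pow_ord_eq_1[of a] pow_ord_eq_1[of b] by (simp_all add: ord_generators)

text \<open>By \<open>product_closed_right_mult\<close> with c = -1 - 8u, the set of products a^i
  b^j absorbs each further letter on the right.\<close>

lemma word_class_factorisation:
  "\<exists>(i :: int) (j :: int). word_class (rels u) w = a [^] i \<otimes> b [^] j"
proof (induction w rule: rev_induct)
  case Nil
  show ?case by (intro exI[of _ 0]) (simp add: class_Nil)
next
  case (snoc l w)
  then obtain i j :: int where ij: "word_class (rels u) w = a [^] i \<otimes> b [^] j" by blast
  have mult_a: "\<exists>(k :: int) (l :: int). a [^] (i :: int) \<otimes> b [^] (j :: int) \<otimes> a = a [^] k \<otimes> b [^] l"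
    for i j
    by (rule product_closed_right_mult[OF a_mem b_mem nat_pow_generators(2)])
      (use u group_relations in auto)
  have mult_a_pow: "\<exists>(k :: int) (l :: int). a [^] i \<otimes> b [^] j \<otimes> a [^] n = a [^] k \<otimes> b [^] l" for n :: nat
  proof (induction n)
    case 0
    show ?case by (intro exI[of _ i] exI[of _ j]) simp
  next
    case (Suc n)
    then obtain k l :: int where "a [^] i \<otimes> b [^] j \<otimes> a [^] n = a [^] k \<otimes> b [^] l" by blast
    then have "a [^] i \<otimes> b [^] j \<otimes> a [^] Suc n = a [^] k \<otimes> b [^] l \<otimes> a"
      by (simp add: m_assoc[symmetric])
    then show ?case using mult_a[of k l] by simp
  qed
  have mult_b: "a [^] i \<otimes> b [^] j \<otimes> b [^] k = a [^] i \<otimes> b [^] (j + k)" for k :: int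
    by (simp add: m_assoc int_pow_mult)
  \<comment> \<open>As the inverse of \<open>a\<close> is a^7, closure under \<open>a\<close> covers
    the inverse letter too.\<close>
  have inv_pow: "inv a = a [^] (7 :: nat)" "inv b = b [^] (-1 :: int)"
    using int_pow_eq_nat_pow[OF a_mem nat_pow_generators(1), of "-1"] by (simp_all add: int_pow_neg)
  have letter: "word_class (rels u) [(Sigma1, True)] = a" "word_class (rels u) [(Sigma1, False)] = inv a"
    "word_class (rels u) [(Sigma2, True)] = b" "word_class (rels u) [(Sigma2, False)] = inv b"
    by (simp_all add: word_class_letter G_def a_def b_def)
  obtain x s where l: "l = (x, s)" by (cases l)
  have "\<exists>(k :: int) (n :: int). a [^] i \<otimes> b [^] j \<otimes> word_class (rels u) [l] = a [^] k \<otimes> b [^] n"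
    using mult_a[of i j] mult_a_pow[of 7] mult_b[of 1] mult_b[of "-1"]
    by (cases x; cases s) (auto simp: l letter inv_pow)
  then show ?case by (simp add: class_append ij)
qed

text \<open>Reduced exponents serve twice: their bounds make the group finite, and as natural
  numbers they fit the factorisation in \<open>tight_rotation_group\<close>.\<close>

lemma carrier_factorisation:
  assumes "x \<in> carrier G"
  shows "\<exists>i<8. \<exists>j<32 * nat \<bar>u\<bar>. x = a [^] (i :: nat) \<otimes> b [^] (j :: nat)"
proof -
  obtain w where "x = word_class (rels u) w" using assms by (auto simp: G_def presented_group_def)
  then obtain i j :: int where "x = a [^] i \<otimes> b [^] j" using word_class_factorisation by metis
  then have "x = a [^] nat (i mod int 8) \<otimes> b [^] nat (j mod int (32 * nat \<bar>u\<bar>))"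
    using int_pow_eq_nat_pow[OF a_mem nat_pow_generators(1), of i]
      int_pow_eq_nat_pow[OF b_mem nat_pow_generators(2), of j] u by simp
  moreover have "nat (i mod int 8) < 8" by simp
  moreover have "nat (j mod int (32 * nat \<bar>u\<bar>)) < 32 * nat \<bar>u\<bar>"
    using u pos_mod_bound[of "32 * \<bar>u\<bar>" j] by (simp add: nat_less_iff)
  ultimately show ?thesis by blast
qed

lemma tight_rotation_group_rels: "tight_rotation_group G a b"
proof unfold_locales
  have "carrier G \<subseteq> (\<lambda>(i, j). a [^] i \<otimes> b [^] j) ` ({..<8 :: nat} \<times> {..<32 * nat \<bar>u\<bar>})"
    using carrier_factorisation by fastforce
  then show "finite (carrier G)" by (rule finite_subset) simp
  show "a \<noteq> \<one>" using pow_eq_one_iff(1)[of 1] by auto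
  show "b \<noteq> \<one>"
  proof
    assume "b = \<one>"
    then have "32 * u dvd 1" using pow_eq_one_iff(2)[of 1] by simp
    then have "32 dvd (1 :: int)" by (rule dvd_mult_left)
    then show False by simp
  qed
  show "a \<otimes> b \<otimes> (a \<otimes> b) = \<one>" by (rule group_relations)
  show "\<exists>(i :: nat) (j :: nat). x = a [^] i \<otimes> b [^] j" if "x \<in> carrier G" for x
    using carrier_factorisation[OF that] by blast
  show "a [^] i = \<one>" if "a [^] i = b [^] j" for i j :: int
  proof -
    have "a [^] i \<otimes> b [^] (- j) = \<one>" using that by (simp add: int_pow_neg)
    then show ?thesis using power_product_eq_one(1) by (simp add: pow_eq_one_iff)
  qed
qed simp_all

text \<open>Inverting both generators in the fourth relation yields the fifth with the opposite sign of
  \<open>u\<close>, which would force \<open>\<sigma>\<^sub>2\<^bsup>16u\<^esup> = 1\<close>.\<close>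

lemma no_inverting_hom: "\<not> (\<exists>\<theta>\<in>hom G G. \<theta> a = inv a \<and> \<theta> b = inv b)"
proof
  assume "\<exists>\<theta>\<in>hom G G. \<theta> a = inv a \<and> \<theta> b = inv b"
  then obtain \<theta> where \<theta>: "\<theta> \<in> hom G G" "\<theta> a = inv a" "\<theta> b = inv b" by blast
  interpret \<theta>: group_hom G G \<theta>
    using \<theta>(1) by unfold_locales
  have "\<theta> (inv b \<otimes> a) = \<theta> (a [^] (3 :: int) \<otimes> b [^] (1 - 8 * u))"
    by (simp add: group_relations)
  then have "b \<otimes> inv a = a [^] (-3 :: int) \<otimes> b [^] (- (1 - 8 * u))"
    using int_pow_neg[of a 3] int_pow_neg[of b "1 - 8 * u"] by (simp add: \<theta>.hom_int_pow \<theta> int_pow_inv)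
  then have "a [^] (-3 :: int) \<otimes> b [^] (-1 - 8 * u) = a [^] (-3 :: int) \<otimes> b [^] (- (1 - 8 * u))"
    by (simp only: group_relations)
  then have "b [^] (-1 - 8 * u) = b [^] (- (1 - 8 * u))"
    by simp
  then have "b [^] (- (1 - 8 * u) - (-1 - 8 * u)) = \<one>"
    by (simp only: int_pow_diff b_mem r_inv int_pow_closed)
  then have "32 * u dvd 16 * u" by (simp add: pow_eq_one_iff)
  then show False using u by (simp add: dvd_mult_cancel_right)
qed

lemma chiral_polyhedron_rels:
  "\<exists>P :: nat ranked_poset. chiral_polyhedron P \<and> has_type P 8 (32 * nat \<bar>u\<bar>) \<and>
    tight P 8 (32 * nat \<bar>u\<bar>) \<and> presents_automorphism_group (rels u) P"
proof -
  interpret tight_rotation_group G a b by (rule tight_rotation_group_rels)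
  have "presents_automorphism_group (rels u) poset"
    unfolding presents_automorphism_group_def
    using iso_Aut_poset[OF no_inverting_hom] distinguished_generators_poset flag_of_mem(1)[OF one_closed]
    unfolding G_def a_def b_def by blast
  then show ?thesis
    using chiral_polyhedron_poset[OF no_inverting_hom] has_type_poset tight_poset
    unfolding ord_generators by blast
qed

end

theorem theorem3p7:
  fixes \<beta> :: nat
  assumes "\<beta> \<ge> 5"
  shows "(\<exists>P :: nat ranked_poset.
            chiral_polyhedron P \<and> has_type P 8 (2 ^ \<beta>) \<and> tight P 8 (2 ^ \<beta>) \<and>
            presents_automorphism_group
              (Gamma_rels 8 (2 ^ \<beta>) 3 (1 - 2 ^ (\<beta> - 2)) (-3) (-1 - 2 ^ (\<beta> - 2))) P) \<and>
         (\<exists>P :: nat ranked_poset.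
            chiral_polyhedron P \<and> has_type P 8 (2 ^ \<beta>) \<and> tight P 8 (2 ^ \<beta>) \<and>
            presents_automorphism_group
              (Gamma_rels 8 (2 ^ \<beta>) 3 (1 + 2 ^ (\<beta> - 2)) (-3) (-1 + 2 ^ (\<beta> - 2))) P)"
proof -
  \<comment> \<open>With n = \<beta> - 5 and u = 2^n one has 32u = 2^\<beta> and 8u = 2^(\<beta> -
    2); the second group is the case u = -2^n.\<close>
  obtain n where \<beta>: "\<beta> = n + 5" using assms by (metis add.commute le_Suc_ex)
  have pow: "(2 :: int) ^ \<beta> = 32 * 2 ^ n" "(2 :: nat) ^ \<beta> = 32 * 2 ^ n" "(2 :: int) ^ (\<beta> - 2) = 8 * 2 ^ n"
    by (simp_all add: \<beta> power_add)
  have "\<bar>2 ^ n :: int\<bar> = 2 ^ n" "\<bar>- (2 ^ n) :: int\<bar> = 2 ^ n" "nat (2 ^ n) = 2 ^ n"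
    by (simp_all add: nat_power_eq)
  then show ?thesis
    using chiral_polyhedron_rels[of "2 ^ n"] chiral_polyhedron_rels[of "- (2 ^ n)"]
    unfolding pow by (simp add: nat_power_eq)
qed

end
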